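(* Let $w\in S_n$, let $m$ be the common length of all climbing chains of $w$, and let $\mathrm{leads}(w)=(L_w(0),\ldots,L_w(d))$, where $d=\mathrm{raj}(w)-\mathrm{inv}(w)$. For $0\le p\le m$ let $\xi_w(p)=(I^p(w),U^p(w))$, where $I^p(w)$ is the $p$th interpolating chain of $w$, $U^0(w)=I^0(w)$, and $$U^p(w)=M(I^p(w))\cup\{I^p(w)_1,I^p(w)_2,\ldots,I^p(w)_{m-p+1}\}\quad\text{for }p\in[m].$$ Then $$\{L_w(0),\ldots,L_w(d)\}=\{\mathrm{wt}(\xi_w(0)),\ldots,\mathrm{wt}(\xi_w(m))\}.$$
   Context: Conventions. Permutations are in one-line notation; $t_{ij}$ is the transposition of $i,j$, and $wt_{ij}$ is $w$ with the values in positions $i$ and $j$ exchanged. $w_0\in S_n$ is the longest permutation, $w_0(k)=n+1-k$. The Bruhat order is the transitive closure of $w\le wt_{ij}$ for $i<j$ with $w(i)<w(j)$; $\lessdot$ denotes its cover relation. $e_1,\dots,e_n$ is the standard basis of $\mathbb{Z}^n$, $|v|=\sum_k v_k$, $[n]=\{1,\ldots,n\}$. Climbing chains. A climbing chain of $w\in S_n$ is a sequence $C=(C_1,\ldots,C_m)$ of pairs (links) $C_p=(i_p,j_p)$ with $i_p<j_p$, $i_1\le\cdots\le i_m$, $wt_{i_1j_1}\cdots t_{i_mj_m}=w_0$, and $wt_{i_1j_1}\cdots t_{i_{p-1}j_{p-1}}\lessdot wt_{i_1j_1}\cdots t_{i_pj_p}$ for each $p\in[m]$. (The only climbing chain of $w_0$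 is empty. The links of a chain are distinct, so $C$ is also regarded as a set. All climbing chains of $w$ have length $m=\ell(w_0)-\ell(w)$, $\ell$ on permutations being the number of inversions.) The set of minimal markings is $M(C)=\{C_p\mid i_{p-1}<i_p,\text{ or } i_{p-1}=i_p\text{ and }j_{p-1}<j_p\}$ with $i_0=0$. A marked climbing chain is a pair $(C,U)$ with $M(C)\subseteq U\subseteq C$. Its weight has $\mathrm{wt}(C,U)_k=n-k-\#\{\text{links of the form }(k,\star)\text{ in }U\}$ for $k\in[n]$. Greedy and nested pairs. Let $w\ne w_0$ and $a=\min\{k\mid w(k)\ne n+1-k\}$. The greedy pair is $\mathrm{greedy}(w)=(a,b)$ with $b=w^{-1}(w(a)+1)$. An increasing subsequence of $w$ starting from position $q$ is $\alpha=(\alpha_1,\ldots,\alpha_r)$ with $q=\alpha_1<\cdots<\alpha_r\le n$ and $w(\alpha_1)<\cdots<w(\alpha_r)$; $\mathrm{LIS}(w,q)$ is the set of those of maximal length $r$. The nested pair is $\mathrm{nested}(w)=(\alpha_1,\alpha_2)$, where $\alpha$ is the lexicographically last element of $\mathrm{LIS}(w,a)$. Interpolating chains. A link $C_p=(i_p,j_p)$ of a climbing chain $C$ of $w$ is greedy (resp. nested) if it equals the greedy (resp. nested) pair of $wt_{i_1j_1}\cdots t_{i_{p-1}j_{p-1}}$. For $0\le k\le m$, $I^k(w)$ is the unique climbing chain of $w$ whose first $m-k$ links are greedy and whose last $k$ links are nested; $I^k(w)_p$ is its $p$th link. Codes. $\mathrm{invcode}(w)_i=\#\{j>i\mid w(j)<w(i)\}$,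 $\mathrm{inv}(w)=|\mathrm{invcode}(w)|$. $\overline{\mathrm{rajcode}}(w)_i$ is the length of any element of $\mathrm{LIS}(w,i)$ minus one; $\mathrm{rajcode}(w)_k=n-k-\overline{\mathrm{rajcode}}(w)_k$; $\mathrm{raj}(w)=|\mathrm{rajcode}(w)|$. One has $\mathrm{rajcode}(w)_k\ge\mathrm{invcode}(w)_k$ for all $k$. Set $L_w(0)=\mathrm{invcode}(w)$; for $1\le i\le d$ let $j\in[n]$ be the largest index with $L_w(i-1)_j<\mathrm{rajcode}(w)_j$ and set $L_w(i)=L_w(i-1)+e_j$. *)

theory Defs
  imports Complex_Main "HOL-Combinatorics.Permutations"
begin

text \<open>Elements of the symmetric group are functions \<open>w\<close> with \<open>w permutes {1..n}\<close>, so
  \<open>w \<circ> transpose i j\<close> is \<open>w\<close> with the values in positions \<open>i\<close> and \<open>j\<close> exchanged. Vectors in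
  \<open>\<int>\<^sup>n\<close> are functions \<^typ>\<open>nat \<Rightarrow> int\<close> that vanish outside \<open>{1..n}\<close>.\<close>

definition longest_perm :: "nat \<Rightarrow> nat \<Rightarrow> nat" where
  "longest_perm n k = (if k \<in> {1..n} then n + 1 - k else k)"

definition unit_vec :: "nat \<Rightarrow> nat \<Rightarrow> int" where
  "unit_vec j k = (if k = j then 1 else 0)"


subsection \<open>Bruhat order\<close>

definition bruhat_step :: "nat \<Rightarrow> (nat \<Rightarrow> nat) \<Rightarrow> (nat \<Rightarrow> nat) \<Rightarrow> bool" where
  "bruhat_step n u v \<longleftrightarrow> u permutes {1..n} \<and>
     (\<exists>i j. 1 \<le> i \<and> i < j \<and> j \<le> n \<and> u i < u j \<and> v = u \<circ> transpose i j)"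

definition bruhat_le :: "nat \<Rightarrow> (nat \<Rightarrow> nat) \<Rightarrow> (nat \<Rightarrow> nat) \<Rightarrow> bool" where
  "bruhat_le n = (bruhat_step n)\<^sup>*\<^sup>*"

definition bruhat_cover :: "nat \<Rightarrow> (nat \<Rightarrow> nat) \<Rightarrow> (nat \<Rightarrow> nat) \<Rightarrow> bool" where
  "bruhat_cover n u v \<longleftrightarrow> bruhat_le n u v \<and> u \<noteq> v \<and>
     (\<forall>z. bruhat_le n u z \<and> bruhat_le n z v \<longrightarrow> z = u \<or> z = v)"


subsection \<open>Climbing chains\<close>

text \<open>Chains are lists of links, so the link \<open>C\<^sub>p\<close> of the usual numbering is \<open>C ! (p - 1)\<close>.\<close>

type_synonym link = "nat \<times> nat"

definition apply_links :: "(nat \<Rightarrow> nat) \<Rightarrow> link list \<Rightarrow> nat \<Rightarrow> nat" where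
  "apply_links w C = foldl (\<lambda>u (i, j). u \<circ> transpose i j) w C"

definition climbing_chain :: "nat \<Rightarrow> (nat \<Rightarrow> nat) \<Rightarrow> link list \<Rightarrow> bool" where
  "climbing_chain n w C \<longleftrightarrow>
     (\<forall>(i, j) \<in> set C. 1 \<le> i \<and> i < j \<and> j \<le> n) \<and>
     sorted (map fst C) \<and>
     apply_links w C = longest_perm n \<and>
     (\<forall>p < length C. bruhat_cover n (apply_links w (take p C)) (apply_links w (take (Suc p) C)))"

definition chain_length :: "nat \<Rightarrow> (nat \<Rightarrow> nat) \<Rightarrow> nat" where
  "chain_length n w = (THE m. length ` {C. climbing_chain n w C} = {m})"

text \<open>The predecessor of \<open>C ! p\<close> is \<open>((0, 0) # C) ! p\<close>; the dummy initial link encodes the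
  convention \<open>i\<^sub>0 = 0\<close>. Its second component is irrelevant, as every link has \<open>i \<ge> 1\<close>.\<close>

definition min_markings :: "link list \<Rightarrow> link set" where
  "min_markings C = {C ! p | p. p < length C \<and>
     (fst (((0, 0) # C) ! p) < fst (C ! p) \<or>
      fst (((0, 0) # C) ! p) = fst (C ! p) \<and> snd (((0, 0) # C) ! p) < snd (C ! p))}"

definition chain_wt :: "nat \<Rightarrow> link list \<times> link set \<Rightarrow> nat \<Rightarrow> int" where
  "chain_wt n = (\<lambda>(C, U) k.
     if k \<in> {1..n} then int n - int k - int (card {l \<in> U. fst l = k}) else 0)"


subsection \<open>Greedy and nested pairs\<close>

text \<open>The functions \<open>first_diff\<close>, \<open>greedy_pair\<close> and \<open>nested_pair\<close> are only meaningful for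
  \<open>w \<noteq> longest_perm n\<close>.\<close>

definition first_diff :: "nat \<Rightarrow> (nat \<Rightarrow> nat) \<Rightarrow> nat" where
  "first_diff n w = Min {k \<in> {1..n}. w k \<noteq> n + 1 - k}"

definition greedy_pair :: "nat \<Rightarrow> (nat \<Rightarrow> nat) \<Rightarrow> link" where
  "greedy_pair n w = (let a = first_diff n w in (a, inv w (w a + 1)))"

definition incr_subseqs :: "nat \<Rightarrow> (nat \<Rightarrow> nat) \<Rightarrow> nat \<Rightarrow> nat list set" where
  "incr_subseqs n w q = {\<alpha>. \<alpha> \<noteq> [] \<and> hd \<alpha> = q \<and> set \<alpha> \<subseteq> {1..n} \<and>
     sorted_wrt (<) \<alpha> \<and> sorted_wrt (<) (map w \<alpha>)}"

definition LIS :: "nat \<Rightarrow> (nat \<Rightarrow> nat) \<Rightarrow> nat \<Rightarrow> nat list set" where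
  "LIS n w q = {\<alpha> \<in> incr_subseqs n w q. \<forall>\<beta> \<in> incr_subseqs n w q. length \<beta> \<le> length \<alpha>}"

definition nested_pair :: "nat \<Rightarrow> (nat \<Rightarrow> nat) \<Rightarrow> link" where
  "nested_pair n w =
     (let S = LIS n w (first_diff n w);
          \<alpha> = (THE \<alpha>. \<alpha> \<in> S \<and> (\<forall>\<beta> \<in> S. \<beta> \<noteq> \<alpha> \<longrightarrow> (\<beta>, \<alpha>) \<in> lex less_than))
      in (\<alpha> ! 0, \<alpha> ! 1))"


subsection \<open>Interpolating chains\<close>

text \<open>In the next two definitions \<open>p\<close> is the zero-based position of the link in the list.\<close>

definition greedy_link :: "nat \<Rightarrow> (nat \<Rightarrow> nat) \<Rightarrow> link list \<Rightarrow> nat \<Rightarrow> bool" where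
  "greedy_link n w C p \<longleftrightarrow> C ! p = greedy_pair n (apply_links w (take p C))"

definition nested_link :: "nat \<Rightarrow> (nat \<Rightarrow> nat) \<Rightarrow> link list \<Rightarrow> nat \<Rightarrow> bool" where
  "nested_link n w C p \<longleftrightarrow> C ! p = nested_pair n (apply_links w (take p C))"

definition interp_chain :: "nat \<Rightarrow> (nat \<Rightarrow> nat) \<Rightarrow> nat \<Rightarrow> link list" where
  "interp_chain n w k = (THE C. climbing_chain n w C \<and>
     (\<forall>p < chain_length n w - k. greedy_link n w C p) \<and>
     (\<forall>p \<in> {chain_length n w - k..<chain_length n w}. nested_link n w C p))"

definition interp_marking :: "nat \<Rightarrow> (nat \<Rightarrow> nat) \<Rightarrow> nat \<Rightarrow> link set" where
  "interp_marking n w p =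
     (if p = 0 then set (interp_chain n w 0)
      else min_markings (interp_chain n w p) \<union>
           set (take (chain_length n w - p + 1) (interp_chain n w p)))"

definition xi :: "nat \<Rightarrow> (nat \<Rightarrow> nat) \<Rightarrow> nat \<Rightarrow> link list \<times> link set" where
  "xi n w p = (interp_chain n w p, interp_marking n w p)"


subsection \<open>Codes\<close>

definition vec_size :: "nat \<Rightarrow> (nat \<Rightarrow> int) \<Rightarrow> int" where
  "vec_size n v = (\<Sum>k = 1..n. v k)"

definition invcode :: "nat \<Rightarrow> (nat \<Rightarrow> nat) \<Rightarrow> nat \<Rightarrow> int" where
  "invcode n w i = (if i \<in> {1..n} then int (card {j \<in> {1..n}. j > i \<and> w j < w i}) else 0)"

definition rajcode_bar :: "nat \<Rightarrow> (nat \<Rightarrow> nat) \<Rightarrow> nat \<Rightarrow> int" where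
  "rajcode_bar n w i = int (length (SOME \<alpha>. \<alpha> \<in> LIS n w i)) - 1"

definition rajcode :: "nat \<Rightarrow> (nat \<Rightarrow> nat) \<Rightarrow> nat \<Rightarrow> int" where
  "rajcode n w k = (if k \<in> {1..n} then int n - int k - rajcode_bar n w k else 0)"

definition inv_size :: "nat \<Rightarrow> (nat \<Rightarrow> nat) \<Rightarrow> int" where
  "inv_size n w = vec_size n (invcode n w)"

definition raj_size :: "nat \<Rightarrow> (nat \<Rightarrow> nat) \<Rightarrow> int" where
  "raj_size n w = vec_size n (rajcode n w)"

primrec lead :: "nat \<Rightarrow> (nat \<Rightarrow> nat) \<Rightarrow> nat \<Rightarrow> nat \<Rightarrow> int" where
  "lead n w 0 = invcode n w"
| "lead n w (Suc i) =
     (\<lambda>k. lead n w i k + unit_vec (Max {j \<in> {1..n}. lead n w i j < rajcode n w j}) k)"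

text \<open>The function \<^const>\<open>nat\<close> does not truncate here, since \<open>rajcode\<close> dominates \<open>invcode\<close>
  componentwise for a permutation.\<close>

definition leads :: "nat \<Rightarrow> (nat \<Rightarrow> nat) \<Rightarrow> (nat \<Rightarrow> int) list" where
  "leads n w = map (lead n w) [0..<nat (raj_size n w - inv_size n w) + 1]"

end

theory Submission
  imports Defs
begin

text \<open>Write \<open>rise u k\<close> for the number of \<open>j > k\<close> with \<open>u k < u j\<close>, \<open>rho u k\<close> for
  \<open>rajcode_bar u k\<close>, and \<open>excess = rise - rho = rajcode - invcode\<close>. A greedy step at position
  \<open>a\<close> lowers \<open>rise\<close> at \<open>a\<close> by one and \<open>rho\<close> at \<open>a\<close> by at most one; a nested step keeps \<open>rho\<close>
  except at \<open>a\<close>, where it drops by one exactly when the chain ends or its next link is minimally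
  marked. Hence the weight of the \<open>p\<close>-th marked interpolating chain is
  \<open>invcode w + excess u\<close>, where \<open>u\<close> is reached from \<open>w\<close> by its greedy links. Both these excess
  vectors and the vectors \<open>L\<^sub>w(i) - invcode w\<close> are truncations of \<open>excess w\<close>: zero before some
  position and unchanged after it. Such a vector is determined by the sum of its entries, and
  along the greedy chain this sum never drops by more than one, so all values are attained.\<close>

section \<open>Rises and longest increasing subsequences\<close>

definition rise :: "nat \<Rightarrow> (nat \<Rightarrow> nat) \<Rightarrow> nat \<Rightarrow> nat" where
  "rise n w k = card {j \<in> {k<..n}. w k < w j}"

text \<open>For a permutation this is the number of noninversions, that is, the length of w_0 minus
  the length of w. It serves as a rank function for the Bruhat order and turns out to be the length
  of every climbing chain.\<close>

definition rises :: "nat \<Rightarrow> (nat \<Rightarrow> nat) \<Rightarrow> nat" where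
  "rises n w = (\<Sum>k = 1..n. rise n w k)"

text \<open>The natural-number form of \<open>rajcode_bar\<close>, without the choice of a longest
  subsequence. For k in {1..n} the singleton [k] is an increasing subsequence, so subtracting 1 does
  not truncate.\<close>

definition rho :: "nat \<Rightarrow> (nat \<Rightarrow> nat) \<Rightarrow> nat \<Rightarrow> nat" where
  "rho n w k = Max (length ` incr_subseqs n w k) - 1"

lemma singleton_incr_subseqs: "q \<in> {1..n} \<Longrightarrow> [q] \<in> incr_subseqs n w q"
  by (simp add: incr_subseqs_def)

lemma finite_incr_subseqs: "finite (incr_subseqs n w q)"
proof (rule finite_subset)
  show "incr_subseqs n w q \<subseteq> {xs. set xs \<subseteq> {1..n} \<and> length xs \<le> n}"
  proof
    fix xs assume "xs \<in> incr_subseqs n w q"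
    then have xs: "set xs \<subseteq> {1..n}" "sorted_wrt (<) xs"
      by (auto simp: incr_subseqs_def)
    then have "length xs = card (set xs)"
      by (simp add: strict_sorted_iff distinct_card)
    also have "\<dots> \<le> n"
      using card_mono[OF _ xs(1)] by simp
    finally show "xs \<in> {xs. set xs \<subseteq> {1..n} \<and> length xs \<le> n}"
      using xs by simp
  qed
qed (simp add: finite_lists_length_le)

lemma length_incr_subseq_le:
  assumes "\<alpha> \<in> incr_subseqs n w q"
  shows "length \<alpha> \<le> Suc (rho n w q)"
proof -
  have "length \<alpha> \<le> Max (length ` incr_subseqs n w q)"
    using assms finite_incr_subseqs by (intro Max_ge) auto
  then show ?thesis
    by (simp add: rho_def)
qed

lemma LIS_eq:
  assumes "q \<in> {1..n}"
  shows "LIS n w q = {\<alpha> \<in> incr_subseqs n w q. length \<alpha> = Suc (rho n w q)}"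
    and "LIS n w q \<noteq> {}"
proof -
  let ?S = "incr_subseqs n w q"
  have "Max (length ` ?S) \<in> length ` ?S"
    using finite_incr_subseqs singleton_incr_subseqs[OF assms, of w] by (intro Max_in) auto
  then obtain \<alpha> where \<alpha>: "\<alpha> \<in> ?S" "length \<alpha> = Max (length ` ?S)"
    by auto
  moreover have "\<alpha> \<noteq> []"
    using \<alpha>(1) by (auto simp: incr_subseqs_def)
  ultimately have len: "length \<alpha> = Suc (rho n w q)"
    by (cases \<alpha>) (auto simp: rho_def)
  show "LIS n w q = {\<alpha> \<in> ?S. length \<alpha> = Suc (rho n w q)}"
    using length_incr_subseq_le[of _ n w q] \<alpha>(1) len by (fastforce simp: LIS_def)
  then show "LIS n w q \<noteq> {}"
    using \<alpha>(1) len by auto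
qed

lemma rajcode_bar_eq: "q \<in> {1..n} \<Longrightarrow> rajcode_bar n w q = int (rho n w q)"
  using LIS_eq[of q n w] some_in_eq[of "LIS n w q"] by (simp add: rajcode_bar_def)

lemma Cons_incr_subseqs:
  assumes "\<beta> \<in> incr_subseqs n w j" "q \<in> {1..n}" "q < j" "w q < w j"
  shows "q # \<beta> \<in> incr_subseqs n w q"
  using assms by (cases \<beta>) (auto simp: incr_subseqs_def)

lemma Cons_incr_subseqsD:
  assumes "x # j # \<gamma> \<in> incr_subseqs n w q"
  shows "x = q" "q < j" "w q < w j" "j \<in> {1..n}" "j # \<gamma> \<in> incr_subseqs n w j"
  using assms by (auto simp: incr_subseqs_def)

lemma rho_ge:
  assumes "i \<in> {1..n}" "j \<in> {i<..n}" "w i < w j"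
  shows "Suc (rho n w j) \<le> rho n w i"
proof -
  have "j \<in> {1..n}"
    using assms by auto
  from LIS_eq[OF this] obtain \<beta> where \<beta>: "\<beta> \<in> incr_subseqs n w j" "length \<beta> = Suc (rho n w j)"
    by blast
  have "i # \<beta> \<in> incr_subseqs n w i"
    using assms \<beta>(1) by (intro Cons_incr_subseqs) auto
  from length_incr_subseq_le[OF this] \<beta>(2) show ?thesis
    by simp
qed

text \<open>The tail of a longest subsequence is an increasing subsequence from its second position
  j, which bounds \<open>rho\<close> at j from below; \<open>rho_ge\<close> bounds it from above.
  Together the two lemmas give a recursion: \<open>rho\<close> is the maximum of 1 +
  \<open>rho\<close> over later larger entries, and 0 if there are none. Comparing
  \<open>rho\<close> before and after an exchange rests on this recursion.\<close>

lemma rho_cases: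
  assumes "i \<in> {1..n}"
  obtains "rho n w i = 0"
    | j where "j \<in> {i<..n}" "w i < w j" "rho n w i = Suc (rho n w j)"
proof (cases "rho n w i = 0")
  case False
  from LIS_eq[OF assms] obtain \<alpha> where \<alpha>: "\<alpha> \<in> incr_subseqs n w i" "length \<alpha> = Suc (rho n w i)"
    by blast
  then obtain x j \<gamma> where eq: "\<alpha> = x # j # \<gamma>"
    using False by (metis Suc_length_conv not0_implies_Suc)
  note j = Cons_incr_subseqsD[OF \<alpha>(1)[unfolded eq]]
  have "rho n w i = Suc (rho n w j)"
    using length_incr_subseq_le[OF j(5)] rho_ge[OF assms, of j w] j \<alpha>(2) eq by simp
  then show ?thesis
    using that(2) j by auto
qed (use that in auto)

text \<open>The recursion for \<open>rho\<close> sees only this data. It is the inductive step when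
  two permutations are compared from right to left.\<close>

lemma rho_cong:
  assumes "i \<in> {1..n}"
    and rise: "\<And>j. j \<in> {i<..n} \<Longrightarrow> w i < w j \<longleftrightarrow> v i < v j"
    and eq: "\<And>j. j \<in> {i<..n} \<Longrightarrow> w i < w j \<Longrightarrow> rho n w j = rho n v j"
  shows "rho n w i = rho n v i"
proof (rule antisym)
  show "rho n w i \<le> rho n v i"
    using assms(1)
    by (cases rule: rho_cases[of i n w]) (use rho_ge[OF assms(1), of _ v] rise eq in auto)
  show "rho n v i \<le> rho n w i"
    using assms(1)
    by (cases rule: rho_cases[of i n v]) (use rho_ge[OF assms(1), of _ w] rise eq in fastforce)+
qed

text \<open>For an optimal successor j, the later entries above w j are also above w i, and j itself
  is one more; so \<open>rise\<close> grows at least as fast as the recursion for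
  \<open>rho\<close>. For permutations this is the inequality between \<open>invcode\<close> and
  \<open>rajcode\<close>.\<close>

lemma rho_le_rise:
  assumes "i \<in> {1..n}"
  shows "rho n w i \<le> rise n w i"
  using assms
proof (induction "n - i" arbitrary: i rule: less_induct)
  case less
  from less.prems show ?case
  proof (cases rule: rho_cases[of i n w])
    case (2 j)
    have "rho n w j \<le> rise n w j"
      using 2 less.prems by (intro less.hyps) auto
    also have "rise n w j < rise n w i"
      unfolding rise_def using 2 by (intro psubset_card_mono) auto
    finally show ?thesis
      using 2 by simp
  qed simp
qed

lemma invcode_eq_rise:
  assumes "w permutes {1..n}" "k \<in> {1..n}"
  shows "invcode n w k = int n - int k - int (rise n w k)"
proof -
  let ?A = "{j \<in> {1..n}. j > k \<and> w j < w k}" and ?B = "{j \<in> {k<..n}. w k < w j}"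
  have "w j \<noteq> w k" if "j > k" for j
    using permutes_inj[OF assms(1)] that by (auto dest: injD)
  then have "j \<in> {k<..n} \<longleftrightarrow> j \<in> ?A \<union> ?B" for j
    using assms(2) by (cases "j > k") (auto simp: neq_iff)
  then have "{k<..n} = ?A \<union> ?B"
    by blast
  then have "card {k<..n} = card (?A \<union> ?B)"
    by (rule arg_cong)
  also have "\<dots> = card ?A + card ?B"
    by (rule card_Un_disjoint) auto
  finally show ?thesis
    using assms(2) by (auto simp: invcode_def rise_def)
qed

lemma rajcode_eq_rho:
  "k \<in> {1..n} \<Longrightarrow> rajcode n w k = int n - int k - int (rho n w k)"
  by (simp add: rajcode_def rajcode_bar_eq)


section \<open>Exchanging two values\<close>

definition act :: "(nat \<Rightarrow> nat) \<Rightarrow> link \<Rightarrow> nat \<Rightarrow> nat" where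
  "act w l = w \<circ> transpose (fst l) (snd l)"

definition valid_link :: "nat \<Rightarrow> (nat \<Rightarrow> nat) \<Rightarrow> link \<Rightarrow> bool" where
  "valid_link n u l \<longleftrightarrow> 1 \<le> fst l \<and> fst l < snd l \<and> snd l \<le> n \<and> u (fst l) < u (snd l)"

text \<open>The classical criterion for Bruhat covers: no position in between carries a value in
  between.\<close>

definition covering_link :: "nat \<Rightarrow> (nat \<Rightarrow> nat) \<Rightarrow> link \<Rightarrow> bool" where
  "covering_link n u l \<longleftrightarrow> valid_link n u l \<and>
     (\<forall>k \<in> {fst l<..<snd l}. \<not> (u (fst l) < u k \<and> u k < u (snd l)))"

lemma act_apply:
  "act u (i, j) i = u j" "act u (i, j) j = u i"
  "k \<noteq> i \<Longrightarrow> k \<noteq> j \<Longrightarrow> act u (i, j) k = u k"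
  by (auto simp: act_def)

lemma act_permutes:
  assumes "u permutes {1..n}" "valid_link n u l"
  shows "act u l permutes {1..n}"
  using assms unfolding act_def valid_link_def
  by (intro permutes_compose permutes_swap_id) auto

text \<open>Both exchanged positions lie to the right of k, so the larger entries there are only
  moved by the transposition.\<close>

lemma rise_act_lower:
  assumes "valid_link n u (i, j)" "k < i"
  shows "rise n (act u (i, j)) k = rise n u k"
proof -
  let ?t = "transpose i j"
  have image: "{l \<in> {k<..n}. act u (i, j) k < act u (i, j) l} = ?t ` {l \<in> {k<..n}. u k < u l}"
    (is "?A = ?t ` ?B")
  proof (intro equalityI subsetI)
    fix l assume "l \<in> ?A"
    then have "?t l \<in> ?B"
      using assms by (auto simp: act_def valid_link_def transpose_def split: if_splits)
    then show "l \<in> ?t ` ?B"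
      by (rule rev_image_eqI) simp
  qed (use assms in \<open>auto simp: act_def valid_link_def transpose_def split: if_splits\<close>)
  show ?thesis
    unfolding rise_def image by (rule card_image) simp
qed

lemma rise_act_upper:
  assumes "valid_link n u (i, j)" "j < k"
  shows "rise n (act u (i, j)) k = rise n u k"
  unfolding rise_def by (rule arg_cong[where f = card]) (use assms in \<open>auto simp: valid_link_def act_apply\<close>)

text \<open>To the right of k only the entry at j changes, and it decreases.\<close>

lemma rise_act_inner:
  assumes "valid_link n u (i, j)" "i < k" "k < j"
  shows "rise n (act u (i, j)) k \<le> rise n u k"
  unfolding rise_def
proof (rule card_mono)
  show "{l \<in> {k<..n}. act u (i, j) k < act u (i, j) l} \<subseteq> {l \<in> {k<..n}. u k < u l}"
  proof
    fix l assume "l \<in> {l \<in> {k<..n}. act u (i, j) k < act u (i, j) l}"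
    then show "l \<in> {l \<in> {k<..n}. u k < u l}"
      using assms by (cases "l = j") (auto simp: valid_link_def act_apply)
  qed
qed simp

lemma rise_act_inner_eq:
  assumes "u permutes {1..n}" "covering_link n u (i, j)" "i < k" "k < j"
  shows "rise n (act u (i, j)) k = rise n u k"
proof -
  have v: "valid_link n u (i, j)" and c: "\<not> (u i < u k \<and> u k < u j)"
    using assms by (auto simp: covering_link_def)
  have "u k \<noteq> u i"
    using permutes_inj[OF assms(1)] assms(3) by (auto dest: injD)
  then have "act u (i, j) k < act u (i, j) l \<longleftrightarrow> u k < u l" if "l > k" for l
    using assms(3,4) c v that by (cases "l = j") (auto simp: act_apply valid_link_def)
  then show ?thesis
    unfolding rise_def by (intro arg_cong[where f = card]) auto
qed

text \<open>Position i loses j itself and the later positions with intermediate values; position j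
  gains those of the latter that lie to its right.\<close>

lemma rise_act_ends:
  assumes "u permutes {1..n}" "valid_link n u (i, j)"
  shows "rise n u i = Suc (rise n (act u (i, j)) i + card {l \<in> {i<..n}. u i < u l \<and> u l < u j})"
    and "rise n (act u (i, j)) j = rise n u j + card {l \<in> {j<..n}. u i < u l \<and> u l < u j}"
proof -
  have v: "1 \<le> i" "i < j" "j \<le> n" "u i < u j"
    using assms(2) by (auto simp: valid_link_def)
  have ne: "u l \<noteq> u j" if "l \<noteq> j" for l
    using permutes_inj[OF assms(1)] that by (auto dest: injD)
  have "{l \<in> {i<..n}. u i < u l} =
      insert j ({l \<in> {i<..n}. act u (i, j) i < act u (i, j) l} \<union> {l \<in> {i<..n}. u i < u l \<and> u l < u j})"
    (is "_ = insert j (?A \<union> ?B)")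
  proof (rule set_eqI)
    fix l
    show "l \<in> {l \<in> {i<..n}. u i < u l} \<longleftrightarrow> l \<in> insert j (?A \<union> ?B)"
      using v ne[of l] by (cases "l = j") (auto simp: act_apply)
  qed
  moreover have "j \<notin> ?A \<union> ?B"
    using v by (auto simp: act_apply)
  moreover have "?A \<inter> ?B = {}"
  proof -
    have False if "l \<in> ?A" "l \<in> ?B" for l
      using that v by (cases "l = j") (auto simp: act_apply)
    then show ?thesis by blast
  qed
  ultimately show "rise n u i = Suc (rise n (act u (i, j)) i + card ?B)"
    by (simp add: rise_def card_Un_disjoint)
  have "{l \<in> {j<..n}. act u (i, j) j < act u (i, j) l} =
      {l \<in> {j<..n}. u j < u l} \<union> {l \<in> {j<..n}. u i < u l \<and> u l < u j}"
    (is "_ = ?C \<union> ?D")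
    using v ne by (auto simp: act_apply nat_neq_iff)
  then have "rise n (act u (i, j)) j = card (?C \<union> ?D)"
    by (simp only: rise_def)
  also have "\<dots> = card ?C + card ?D"
    by (rule card_Un_disjoint) auto
  finally show "rise n (act u (i, j)) j = rise n u j + card ?D"
    by (simp only: rise_def)
qed

lemma sum_remove2:
  fixes f :: "'a \<Rightarrow> 'b::comm_monoid_add"
  assumes "finite A" "x \<in> A" "y \<in> A" "x \<noteq> y"
  shows "sum f A = f x + f y + sum f (A - {x, y})"
proof -
  have "sum f A = f x + (f y + sum f (A - {x} - {y}))"
    using assms by (simp add: sum.remove[of A x] sum.remove[of "A - {x}" y])
  moreover have "A - {x} - {y} = A - {x, y}"
    by auto
  ultimately show ?thesis
    by (simp add: add.assoc)
qed

text \<open>The gain at j is at most the loss at i minus one, and no other position gains.\<close>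

lemma rises_act_less:
  assumes "u permutes {1..n}" "valid_link n u l"
  shows "rises n (act u l) < rises n u"
proof -
  obtain i j where l: "l = (i, j)"
    by force
  let ?v = "act u (i, j)" and ?A = "{1..n} - {i, j}"
  have ij: "i < j" "i \<in> {1..n}" "j \<in> {1..n}"
    using assms(2) l by (auto simp: valid_link_def)
  have "card {l \<in> {j<..n}. u i < u l \<and> u l < u j} \<le> card {l \<in> {i<..n}. u i < u l \<and> u l < u j}"
    using ij by (intro card_mono) auto
  then have "rise n ?v i + rise n ?v j < rise n u i + rise n u j"
    using rise_act_ends[OF assms(1), of i j] assms(2) l by simp
  moreover have "rise n ?v k \<le> rise n u k" if "k \<in> ?A" for k
    using that rise_act_lower[of n u i j k] rise_act_upper[of n u i j k]
      rise_act_inner[of n u i j k] assms(2) l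
    by (cases "k < i"; cases "j < k") auto
  then have "sum (rise n ?v) ?A \<le> sum (rise n u) ?A"
    by (rule sum_mono)
  ultimately show ?thesis
    using ij sum_remove2[of "{1..n}" i j "rise n u"] sum_remove2[of "{1..n}" i j "rise n ?v"]
    by (simp add: rises_def l)
qed

text \<open>Every intermediate value to the right of i lies to the right of j, so gain and loss at
  the two ends differ by exactly one.\<close>

lemma rises_act_covering:
  assumes "u permutes {1..n}" "covering_link n u l"
  shows "rises n u = Suc (rises n (act u l))"
proof -
  obtain i j where l: "l = (i, j)"
    by force
  let ?v = "act u (i, j)" and ?A = "{1..n} - {i, j}"
  have v: "valid_link n u (i, j)"
    using assms(2) l by (simp add: covering_link_def)
  then have ij: "i < j" "i \<in> {1..n}" "j \<in> {1..n}"
    by (auto simp: valid_link_def)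
  have "x \<in> {l \<in> {j<..n}. u i < u l \<and> u l < u j} \<longleftrightarrow> x \<in> {l \<in> {i<..n}. u i < u l \<and> u l < u j}" for x
    using assms(2) ij l by (cases x j rule: linorder_cases) (auto simp: covering_link_def)
  then have "{l \<in> {j<..n}. u i < u l \<and> u l < u j} = {l \<in> {i<..n}. u i < u l \<and> u l < u j}"
    by blast
  then have "rise n u i + rise n u j = Suc (rise n ?v i + rise n ?v j)"
    using rise_act_ends[OF assms(1) v] by simp
  moreover have "rise n ?v k = rise n u k" if "k \<in> ?A" for k
    using that rise_act_lower[of n u i j k] rise_act_upper[of n u i j k]
      rise_act_inner_eq[of u n i j k] assms l v
    by (cases "k < i"; cases "j < k") auto
  then have "sum (rise n ?v) ?A = sum (rise n u) ?A"
    by (intro sum.cong) auto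
  ultimately show ?thesis
    using ij sum_remove2[of "{1..n}" i j "rise n u"] sum_remove2[of "{1..n}" i j "rise n ?v"]
    by (simp add: rises_def l)
qed


section \<open>Covers in the Bruhat order\<close>

lemma bruhat_step_iff:
  "bruhat_step n u v \<longleftrightarrow> u permutes {1..n} \<and> (\<exists>l. valid_link n u l \<and> v = act u l)"
  by (auto simp: bruhat_step_def valid_link_def act_def)

lemma bruhat_step_act:
  "u permutes {1..n} \<Longrightarrow> valid_link n u l \<Longrightarrow> bruhat_step n u (act u l)"
  unfolding bruhat_step_iff by blast

lemma bruhat_step_rises: "bruhat_step n u v \<Longrightarrow> rises n v < rises n u"
  unfolding bruhat_step_iff using rises_act_less by blast

lemma bruhat_le_rises:
  "bruhat_le n u v \<Longrightarrow> u = v \<or> rises n v < rises n u"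
  unfolding bruhat_le_def
proof (induction rule: rtranclp_induct)
  case (step y z)
  then show ?case
    using bruhat_step_rises[of n y z] by auto
qed simp

text \<open>\<open>rises\<close> drops strictly along the Bruhat order and here only by one, which
  leaves no room for a permutation in between.\<close>

lemma covering_link_bruhat_cover:
  assumes "u permutes {1..n}" "covering_link n u l"
  shows "bruhat_cover n u (act u l)"
proof -
  have r: "rises n u = Suc (rises n (act u l))"
    using assms by (rule rises_act_covering)
  have "bruhat_le n u (act u l)"
    unfolding bruhat_le_def using assms
    by (intro r_into_rtranclp bruhat_step_act) (auto simp: covering_link_def)
  moreover have "z = u \<or> z = act u l" if "bruhat_le n u z" "bruhat_le n z (act u l)" for z
    using that[THEN bruhat_le_rises] r by auto
  ultimately show ?thesis
    using r by (auto simp: bruhat_cover_def)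
qed

text \<open>With an intermediate value at k, the exchange of i and j factors into the exchanges (i,
  k), (k, j), (i, k), each of which goes up.\<close>

lemma valid_not_covering_intermediate:
  assumes "u permutes {1..n}" "valid_link n u l" "\<not> covering_link n u l"
  obtains z where "bruhat_step n u z" "bruhat_le n z (act u l)" "z \<noteq> act u l"
proof -
  obtain i j where l: "l = (i, j)"
    by force
  obtain k where k: "i < k" "k < j" "u i < u k" "u k < u j" and v: "1 \<le> i" "j \<le> n"
    using assms l by (auto simp: covering_link_def valid_link_def)
  let ?z = "act u (i, k)"
  have vz: "valid_link n u (i, k)"
    using k v by (simp add: valid_link_def)
  note pz = act_permutes[OF assms(1) vz]
  have vy: "valid_link n ?z (k, j)"
    using k v by (simp add: valid_link_def act_apply)
  note py = act_permutes[OF pz vy]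
  have vx: "valid_link n (act ?z (k, j)) (i, k)"
    using k v by (simp add: valid_link_def act_apply)
  have "act (act ?z (k, j)) (i, k) = act u l"
    using k l by (auto simp: act_def fun_eq_iff transpose_def)
  then have "bruhat_le n ?z (act u l)"
    unfolding bruhat_le_def
    using bruhat_step_act[OF pz vy] bruhat_step_act[OF py vx]
    by (metis converse_rtranclp_into_rtranclp rtranclp.rtrancl_refl)
  moreover have "?z i \<noteq> act u l i"
    using k l by (simp add: act_apply)
  ultimately show ?thesis
    using that[of ?z] bruhat_step_act[OF assms(1) vz] by metis
qed

text \<open>The first step of a Bruhat path from u to v must already end in v, and its link is
  covering, since otherwise the factorization above yields a permutation strictly in
  between.\<close>

lemma bruhat_cover_rises:
  assumes "bruhat_cover n u v"
  shows "v permutes {1..n}" "rises n u = Suc (rises n v)"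
proof -
  have le: "bruhat_le n u v" "u \<noteq> v"
    and c: "\<And>z. bruhat_le n u z \<Longrightarrow> bruhat_le n z v \<Longrightarrow> z = u \<or> z = v"
    using assms by (auto simp: bruhat_cover_def)
  then obtain z where z: "bruhat_step n u z" "bruhat_le n z v"
    unfolding bruhat_le_def by (metis converse_rtranclpE)
  then obtain l where u: "u permutes {1..n}" and l: "valid_link n u l" "z = act u l"
    by (auto simp: bruhat_step_iff)
  have "z \<noteq> u"
    using rises_act_less[OF u l(1)] l(2) by auto
  then have v: "v = act u l"
    using c[of z] z l by (auto simp: bruhat_le_def)
  have "covering_link n u l"
  proof (rule ccontr)
    assume "\<not> covering_link n u l"
    then obtain y where y: "bruhat_step n u y" "bruhat_le n y v" "y \<noteq> v"
      using valid_not_covering_intermediate[OF u l(1)] v by metis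
    then have "y = u"
      using c[of y] by (auto simp: bruhat_le_def)
    then show False
      using bruhat_step_rises[OF y(1)] by simp
  qed
  then show "rises n u = Suc (rises n v)"
    using rises_act_covering[OF u] v by simp
  show "v permutes {1..n}"
    using act_permutes[OF u l(1)] v by simp
qed


section \<open>Climbing chains from link selectors\<close>

lemma apply_links_simps [simp]:
  "apply_links w [] = w"
  "apply_links w (l # C) = apply_links (act w l) C"
  "apply_links w (C @ C') = apply_links (apply_links w C) C'"
  by (auto simp: apply_links_def act_def split: prod.splits)

lemma climbing_chain_Nil [simp]: "climbing_chain n w [] \<longleftrightarrow> w = longest_perm n"
  by (simp add: climbing_chain_def)

lemma climbing_chain_Cons:
  "climbing_chain n w (l # C) \<longleftrightarrow>
     1 \<le> fst l \<and> fst l < snd l \<and> snd l \<le> n \<and> (\<forall>l' \<in> set C. fst l \<le> fst l') \<and>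
     bruhat_cover n w (act w l) \<and> climbing_chain n (act w l) C"
  by (cases l) (auto simp: climbing_chain_def All_less_Suc2)

lemma rise_longest_perm: "k \<in> {1..n} \<Longrightarrow> rise n (longest_perm n) k = 0"
  by (auto simp: rise_def longest_perm_def)

lemma rises_longest_perm: "rises n (longest_perm n) = 0"
  by (simp add: rises_def rise_longest_perm)

text \<open>\<open>rises\<close> drops by exactly one along each cover and vanishes at w_0.\<close>

lemma length_climbing_chain:
  "climbing_chain n w C \<Longrightarrow> length C = rises n w"
  by (induction C arbitrary: w)
    (auto simp: climbing_chain_Cons rises_longest_perm dest: bruhat_cover_rises)

section \<open>The first position where a permutation differs from w_0\<close>

context
  fixes n :: nat and u :: "nat \<Rightarrow> nat"
  assumes perm: "u permutes {1..n}" and not_longest: "u \<noteq> longest_perm n"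
begin

lemma first_diff_mem: "first_diff n u \<in> {1..n}"
  and first_diff_neq: "u (first_diff n u) \<noteq> n + 1 - first_diff n u"
  and below_first_diff: "k \<in> {1..<first_diff n u} \<Longrightarrow> u k = n + 1 - k"
proof -
  let ?S = "{k \<in> {1..n}. u k \<noteq> n + 1 - k}"
  have "?S \<noteq> {}"
  proof
    assume "?S = {}"
    then have "u k = longest_perm n k" for k
      using permutes_not_in[OF perm] by (auto simp: longest_perm_def)
    then show False
      using not_longest by auto
  qed
  then have m: "first_diff n u \<in> ?S"
    unfolding first_diff_def by (intro Min_in) auto
  then show "first_diff n u \<in> {1..n}" "u (first_diff n u) \<noteq> n + 1 - first_diff n u"
    by auto
  assume k: "k \<in> {1..<first_diff n u}"
  show "u k = n + 1 - k"
  proof (rule ccontr)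
    assume "u k \<noteq> n + 1 - k"
    then have "first_diff n u \<le> k"
      unfolding first_diff_def using k m by (intro Min_le) auto
    then show False
      using k by simp
  qed
qed

lemma first_diff_geI:
  assumes "\<And>k. k \<in> {1..<a} \<Longrightarrow> u k = n + 1 - k"
  shows "a \<le> first_diff n u"
proof (rule ccontr)
  assume "\<not> a \<le> first_diff n u"
  then show False
    using assms[of "first_diff n u"] first_diff_mem first_diff_neq by simp
qed

end

text \<open>The positions before a use up all values above n + 1 - a, so injectivity leaves none of
  them for j.\<close>

lemma value_above_prefix:
  fixes n :: nat
  assumes perm: "u permutes {1..n}" and prefix: "\<And>k. k \<in> {1..<a} \<Longrightarrow> u k = n + 1 - k"
    and "j \<in> {a..n}" "1 \<le> a"
  shows "u j \<le> n + 1 - a"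
proof (rule ccontr)
  assume *: "\<not> u j \<le> n + 1 - a"
  have j: "u j \<in> {1..n}"
    unfolding permutes_in_image[OF perm] using assms(3,4) by auto
  let ?k = "n + 1 - u j"
  have "?k \<in> {1..<a}"
    using * j assms(3,4) by auto
  then have "u ?k = u j"
    using prefix[of ?k] j by auto
  then have "?k = j"
    using permutes_inj[OF perm] by (auto dest: injD)
  then show False
    using * assms(3,4) j by auto
qed

lemma rise_prefix:
  assumes "u permutes {1..n}" "\<And>k. k \<in> {1..<a} \<Longrightarrow> u k = n + 1 - k"
    and "k \<in> {1..<a}" "k \<le> n"
  shows "rise n u k = 0"
proof -
  have "u j \<le> u k" if "j \<in> {k<..n}" for j
    using value_above_prefix[of u n k j] assms that by auto
  then show ?thesis
    by (force simp: rise_def)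
qed

section \<open>Positions exchanged by the greedy and nested pairs\<close>

lemma greedy_pair_props:
  assumes "u permutes {1..n}" "u \<noteq> longest_perm n"
  obtains b where "greedy_pair n u = (first_diff n u, b)" "b \<in> {first_diff n u<..n}"
    "u b = Suc (u (first_diff n u))"
proof -
  let ?a = "first_diff n u"
  let ?b = "inv u (u ?a + 1)"
  note a = first_diff_mem[OF assms] first_diff_neq[OF assms] below_first_diff[OF assms]
  have b: "u ?b = Suc (u ?a)"
    using permutes_inverses(1)[OF assms(1)] by simp
  \<comment> \<open>The bound n + 1 - a for the value at a is not attained, so the next value is
    still in {1..n}.\<close>
  have le: "u ?a < n + 1 - ?a"
    using value_above_prefix[OF assms(1) a(3), of ?a ?a] a by auto
  then have "u ?b \<in> {1..n}"
    using b a(1) by auto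
  then have "?b \<in> {1..n}"
    by (simp only: permutes_in_image[OF assms(1)])
  \<comment> \<open>Before a all values exceed n + 1 - a, whereas the value at b does not.\<close>
  moreover have "?a < ?b"
  proof (rule ccontr)
    assume "\<not> ?a < ?b"
    then consider "?b = ?a" | "?b \<in> {1..<?a}"
      using \<open>?b \<in> {1..n}\<close> by fastforce
    then show False
      using a(3)[of ?b] b le by cases auto
  qed
  ultimately show ?thesis
    using that[of ?b] b by (auto simp: greedy_pair_def Let_def)
qed

text \<open>Being lexicographically last makes the second entry the last position that attains the
  maximum in the recursion for \<open>rho\<close> at a. The later arguments use the nested pair only
  through these properties.\<close>

lemma nested_pair_props:
  assumes "u permutes {1..n}" "u \<noteq> longest_perm n"
  obtains b where "nested_pair n u = (first_diff n u, b)" "b \<in> {first_diff n u<..n}"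
    "u (first_diff n u) < u b" "rho n u (first_diff n u) = Suc (rho n u b)"
    "\<And>j. j \<in> {b<..n} \<Longrightarrow> u (first_diff n u) < u j \<Longrightarrow> rho n u (first_diff n u) \<noteq> Suc (rho n u j)"
proof -
  let ?a = "first_diff n u"
  let ?S = "LIS n u ?a"
  let ?P = "\<lambda>\<alpha>. \<alpha> \<in> ?S \<and> (\<forall>\<beta> \<in> ?S. \<beta> \<noteq> \<alpha> \<longrightarrow> (\<beta>, \<alpha>) \<in> lex less_than)"
  note a = first_diff_mem[OF assms]
  note S = LIS_eq[OF a, of u]
  \<comment> \<open>The greedy partner is a later larger entry, so a longest subsequence has a
    second entry.\<close>
  obtain c where "c \<in> {?a<..n}" "u ?a < u c"
    using greedy_pair_props[OF assms] by (metis lessI)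
  from rho_ge[OF a this] have pos: "rho n u ?a > 0"
    by simp
  have len: "length \<alpha> = Suc (rho n u ?a)" if "\<alpha> \<in> ?S" for \<alpha>
    using that S(1) by auto
  have fin: "finite ?S"
    using finite_incr_subseqs by (auto simp: LIS_def)
  have asym: "\<not> (\<beta>, \<alpha>) \<in> lex less_than" if "(\<alpha>, \<beta>) \<in> lex less_than" for \<alpha> \<beta> :: "nat list"
    using that wf_not_sym[OF wf_lex[OF wf_less_than]] by blast
  let ?R = "\<lambda>\<alpha> \<beta>. (\<alpha>, \<beta>) \<in> lex less_than"
  have "asymp_on ?S ?R"
    using asym by (intro asymp_onI)
  moreover have "transp_on ?S ?R"
    using lex_transI[OF trans_less_than] by (intro transp_onI) (rule transD)
  ultimately have "\<exists>\<alpha> \<in> ?S. \<forall>\<beta> \<in> ?S. \<beta> \<noteq> \<alpha> \<longrightarrow> \<not> (\<alpha>, \<beta>) \<in> lex less_than"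
    using Finite_Set.bex_max_element[OF fin _ _ S(2), of ?R] by blast
  moreover have "(\<alpha>, \<beta>) \<in> lex less_than \<or> (\<beta>, \<alpha>) \<in> lex less_than" if "\<alpha> \<in> ?S" "\<beta> \<in> ?S" "\<beta> \<noteq> \<alpha>" for \<alpha> \<beta>
  proof -
    \<comment> \<open>All candidates have the same length, and on lists of equal length the total
      order \<open>lenlex\<close> agrees with \<open>lex\<close>.\<close>
    have "(\<alpha>, \<beta>) \<in> lenlex less_than \<or> (\<beta>, \<alpha>) \<in> lenlex less_than"
      using total_lenlex[OF total_less_than] that(3) unfolding total_on_def by blast
    then show ?thesis
      using len[OF that(1)] len[OF that(2)] by (simp add: lenlex_conv)
  qed
  ultimately obtain \<alpha> where \<alpha>: "?P \<alpha>"
    by metis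
  have "(THE \<alpha>. ?P \<alpha>) = \<alpha>"
    using \<alpha> asym by (intro the_equality) metis+
  then have np: "nested_pair n u = (\<alpha> ! 0, \<alpha> ! 1)"
    by (simp add: nested_pair_def Let_def)
  obtain x b \<gamma> where eq: "\<alpha> = x # b # \<gamma>"
    using len[of \<alpha>] \<alpha> pos by (metis Suc_length_conv gr0_implies_Suc)
  then have "x # b # \<gamma> \<in> incr_subseqs n u ?a"
    using \<alpha> S(1) by auto
  note b = Cons_incr_subseqsD[OF this]
  show ?thesis
  proof (rule that[of b])
    show "nested_pair n u = (?a, b)"
      using np eq b by simp
    show "b \<in> {?a<..n}" "u ?a < u b"
      using b by auto
    show "rho n u ?a = Suc (rho n u b)"
      using length_incr_subseq_le[OF b(5)] len[of \<alpha>] \<alpha> eq rho_ge[OF a, of b u] b by auto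
    fix j assume j: "j \<in> {b<..n}" "u ?a < u j"
    show "rho n u ?a \<noteq> Suc (rho n u j)"
    proof
      assume r: "rho n u ?a = Suc (rho n u j)"
      have "j \<in> {1..n}"
        using j b by auto
      from LIS_eq[OF this] obtain \<beta> where \<beta>: "\<beta> \<in> incr_subseqs n u j" "length \<beta> = Suc (rho n u j)"
        by blast
      \<comment> \<open>This longest subsequence would be lexicographically later than \<alpha>, as
        b < j.\<close>
      have "?a # \<beta> \<in> ?S"
        using Cons_incr_subseqs[OF \<beta>(1) a] j b \<beta>(2) r S(1) by auto
      moreover have "hd \<beta> = j" "\<beta> \<noteq> []"
        using \<beta>(1) by (auto simp: incr_subseqs_def)
      ultimately show False
        using \<alpha> eq b(1) j by (cases \<beta>) auto
    qed
  qed
qed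

text \<open>What greedy and nested pairs have in common. It suffices for generating climbing chains,
  so chains that mix both kinds of links need no separate treatment.\<close>

definition selector :: "nat \<Rightarrow> ((nat \<Rightarrow> nat) \<Rightarrow> link) \<Rightarrow> bool" where
  "selector n f \<longleftrightarrow> (\<forall>u. u permutes {1..n} \<longrightarrow> u \<noteq> longest_perm n \<longrightarrow>
     fst (f u) = first_diff n u \<and> covering_link n u (f u))"

lemma selector_greedy: "selector n (greedy_pair n)"
  unfolding selector_def
proof (intro allI impI)
  fix u assume u: "u permutes {1..n}" "u \<noteq> longest_perm n"
  obtain b where "greedy_pair n u = (first_diff n u, b)" "b \<in> {first_diff n u<..n}"
    "u b = Suc (u (first_diff n u))"
    using u by (rule greedy_pair_props)
  then show "fst (greedy_pair n u) = first_diff n u \<and> covering_link n u (greedy_pair n u)"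
    using first_diff_mem[OF u] by (auto simp: covering_link_def valid_link_def)
qed

text \<open>An intermediate value at a position between a and b could be inserted into the
  subsequence, forcing \<open>rho\<close> at a to exceed \<open>rho\<close> at b by two.\<close>

lemma selector_nested: "selector n (nested_pair n)"
  unfolding selector_def
proof (intro allI impI)
  fix u assume u: "u permutes {1..n}" "u \<noteq> longest_perm n"
  let ?a = "first_diff n u"
  note a = first_diff_mem[OF u]
  obtain b where b: "nested_pair n u = (?a, b)" "b \<in> {?a<..n}" "u ?a < u b"
    "rho n u ?a = Suc (rho n u b)"
    using u by (rule nested_pair_props)
  have "\<not> (u ?a < u k \<and> u k < u b)" if "k \<in> {?a<..<b}" for k
    using rho_ge[of ?a n k u] rho_ge[of k n b u] that a b by auto
  then show "fst (nested_pair n u) = ?a \<and> covering_link n u (nested_pair n u)"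
    using a b by (auto simp: covering_link_def valid_link_def)
qed

context
  fixes n :: nat and f :: "(nat \<Rightarrow> nat) \<Rightarrow> link" and u :: "nat \<Rightarrow> nat"
  assumes f: "selector n f" and perm: "u permutes {1..n}" and not_longest: "u \<noteq> longest_perm n"
begin

lemma selector_props:
  "fst (f u) = first_diff n u" "covering_link n u (f u)" "valid_link n u (f u)"
  "act u (f u) permutes {1..n}" "rises n u = Suc (rises n (act u (f u)))"
  using f perm not_longest act_permutes[OF perm, of "f u"] rises_act_covering[OF perm, of "f u"]
  by (auto simp: selector_def covering_link_def)

lemma selector_prefix:
  assumes "k \<in> {1..<first_diff n u}"
  shows "act u (f u) k = n + 1 - k"
proof -
  have "act u (f u) k = u k"
    using selector_props(1,3) assms by (cases "f u") (auto simp: act_apply valid_link_def)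
  then show ?thesis
    using below_first_diff[OF perm not_longest assms] by simp
qed

lemma selector_first_diff:
  "act u (f u) \<noteq> longest_perm n \<Longrightarrow> first_diff n u \<le> first_diff n (act u (f u))"
  using first_diff_geI[OF selector_props(4)] selector_prefix by blast

end

text \<open>Away from w_0 a greedy step exists and lowers \<open>rises\<close>.\<close>

lemma rises_eq_0_iff:
  assumes "u permutes {1..n}"
  shows "rises n u = 0 \<longleftrightarrow> u = longest_perm n"
  using selector_props(5)[OF selector_greedy assms] rises_longest_perm[of n] by (metis nat.distinct(1))

text \<open>One selector per link, so that an interpolating chain comes from a block of greedy
  selectors followed by a block of nested ones.\<close>

primrec chain_of :: "((nat \<Rightarrow> nat) \<Rightarrow> link) list \<Rightarrow> (nat \<Rightarrow> nat) \<Rightarrow> link list" where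
  "chain_of [] u = []"
| "chain_of (f # fs) u = f u # chain_of fs (act u (f u))"

lemma length_chain_of [simp]: "length (chain_of fs u) = length fs"
  by (induction fs arbitrary: u) auto

lemma chain_of_append:
  "chain_of (fs @ gs) u = chain_of fs u @ chain_of gs (apply_links u (chain_of fs u))"
  by (induction fs arbitrary: u) auto

lemma chain_of_nth:
  "p < length fs \<Longrightarrow> chain_of fs u ! p = (fs ! p) (apply_links u (take p (chain_of fs u)))"
  by (induction fs arbitrary: u p) (auto simp: nth_Cons split: nat.splits)

lemma chain_of_unique:
  assumes "length C = length fs"
    and "\<And>p. p < length fs \<Longrightarrow> C ! p = (fs ! p) (apply_links u (take p C))"
  shows "C = chain_of fs u"
  using assms
proof (induction fs arbitrary: u C)
  case (Cons f fs)
  then obtain l C' where C: "C = l # C'"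
    by (cases C) auto
  have l: "l = f u"
    using Cons.prems(2)[of 0] C by simp
  have "C' = chain_of fs (act u l)"
  proof (rule Cons.IH)
    fix p assume "p < length fs"
    then show "C' ! p = (fs ! p) (apply_links (act u l) (take p C'))"
      using Cons.prems(2)[of "Suc p"] C by simp
  qed (use Cons.prems(1) C in simp)
  then show ?case
    using C l by simp
qed simp

lemma chain_of_state:
  assumes "u permutes {1..n}" "length fs \<le> rises n u" "\<forall>f \<in> set fs. selector n f"
  shows "apply_links u (chain_of fs u) permutes {1..n} \<and>
    rises n (apply_links u (chain_of fs u)) = rises n u - length fs"
  using assms
proof (induction fs arbitrary: u)
  case (Cons f fs)
  have "u \<noteq> longest_perm n" "selector n f"
    using Cons.prems rises_eq_0_iff[of u n] by auto
  note f = selector_props[OF this(2) Cons.prems(1) this(1)]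
  show ?case
    using Cons.IH[OF f(4)] Cons.prems f(5) by simp
qed simp

text \<open>The first difference from w_0 never moves left along the chain; this is why the links
  come out sorted by first component.\<close>

lemma first_diff_le_chain_of:
  assumes "u permutes {1..n}" "length fs \<le> rises n u" "\<forall>f \<in> set fs. selector n f"
    and "l \<in> set (chain_of fs u)"
  shows "first_diff n u \<le> fst l"
  using assms
proof (induction fs arbitrary: u)
  case (Cons f fs)
  have u: "u \<noteq> longest_perm n" "selector n f"
    using Cons.prems rises_eq_0_iff[of u n] by auto
  note f = selector_props[OF u(2) Cons.prems(1) u(1)]
  show ?case
  proof (cases "l = f u")
    case False
    then have l: "l \<in> set (chain_of fs (act u (f u)))"
      using Cons.prems by simp
    then have "act u (f u) \<noteq> longest_perm n"
      using Cons.prems f(5) rises_eq_0_iff[OF f(4)] by (cases fs) auto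
    then have "first_diff n u \<le> first_diff n (act u (f u))"
      by (rule selector_first_diff[OF u(2) Cons.prems(1) u(1)])
    also have "\<dots> \<le> fst l"
      using Cons.IH[OF f(4) _ _ l] Cons.prems f(5) by simp
    finally show ?thesis .
  qed (use f in simp)
qed simp

lemma climbing_chain_of:
  assumes "u permutes {1..n}" "length fs = rises n u" "\<forall>f \<in> set fs. selector n f"
  shows "climbing_chain n u (chain_of fs u)"
  using assms
proof (induction fs arbitrary: u)
  case Nil
  then show ?case
    using rises_eq_0_iff by simp
next
  case (Cons f fs)
  have u: "u \<noteq> longest_perm n" "selector n f"
    using Cons.prems rises_eq_0_iff[of u n] by auto
  note f = selector_props[OF u(2) Cons.prems(1) u(1)]
  have "fst (f u) \<le> fst l" if "l \<in> set (chain_of fs (act u (f u)))" for l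
    using first_diff_le_chain_of[of u n "f # fs" l] Cons.prems that f(1) by simp
  moreover have "bruhat_cover n u (act u (f u))"
    using covering_link_bruhat_cover[OF Cons.prems(1) f(2)] .
  moreover have "climbing_chain n (act u (f u)) (chain_of fs (act u (f u)))"
    using Cons.IH[OF f(4)] Cons.prems f(5) by simp
  ultimately show ?case
    using f(3) by (simp add: climbing_chain_Cons valid_link_def)
qed

text \<open>While the links start at \<open>a\<close>, the value at \<open>a\<close> increases and no other value does, so an
  exchanged position is never exchanged with \<open>a\<close> again.\<close>

lemma link_not_in_chain_of:
  assumes "u permutes {1..n}" "length fs \<le> rises n u" "\<forall>f \<in> set fs. selector n f"
    and "a < b" "u b < u a" "u \<noteq> longest_perm n \<Longrightarrow> a \<le> first_diff n u"
  shows "(a, b) \<notin> set (chain_of fs u)"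
  using assms
proof (induction fs arbitrary: u)
  case (Cons f fs)
  have u: "u \<noteq> longest_perm n" "selector n f"
    using Cons.prems rises_eq_0_iff[of u n] by auto
  note f = selector_props[OF u(2) Cons.prems(1) u(1)]
  obtain i j where ij: "f u = (i, j)"
    by force
  have v: "i < j" "u i < u j" "i = first_diff n u"
    using f(1,3) ij by (auto simp: valid_link_def)
  show ?case
  proof (cases "a < i")
    case True
    then show ?thesis
      using first_diff_le_chain_of[of u n "f # fs" "(a, b)"] Cons.prems v by auto
  next
    case False
    then have a: "a = i"
      using Cons.prems(6) u v by simp
    then have "b \<noteq> j" "b \<noteq> i"
      using v Cons.prems(4,5) by auto
    then have "act u (i, j) b < act u (i, j) a"
      using a v Cons.prems(5) by (simp add: act_apply)
    then have "(a, b) \<notin> set (chain_of fs (act u (f u)))"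
      using Cons.IH[OF f(4)] Cons.prems(2-4) f(5) ij a v(3)
        selector_first_diff[OF u(2) Cons.prems(1) u(1)] by simp
    then show ?thesis
      using v Cons.prems(5) ij by auto
  qed
qed simp

text \<open>Once i and j are exchanged, the value at i is the larger one, so the link cannot
  recur.\<close>

lemma distinct_chain_of:
  assumes "u permutes {1..n}" "length fs \<le> rises n u" "\<forall>f \<in> set fs. selector n f"
  shows "distinct (chain_of fs u)"
  using assms
proof (induction fs arbitrary: u)
  case (Cons f fs)
  have u: "u \<noteq> longest_perm n" "selector n f"
    using Cons.prems rises_eq_0_iff[of u n] by auto
  note f = selector_props[OF u(2) Cons.prems(1) u(1)]
  obtain i j where ij: "f u = (i, j)"
    by force
  have v: "i < j" "u i < u j" "i = first_diff n u"
    using f(1,3) ij by (auto simp: valid_link_def)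
  have "(i, j) \<notin> set (chain_of fs (act u (f u)))"
    by (rule link_not_in_chain_of[OF f(4)])
      (use Cons.prems f(5) v ij selector_first_diff[OF u(2) Cons.prems(1) u(1)]
        in \<open>auto simp: act_apply\<close>)
  then show ?case
    using Cons.IH[OF f(4)] Cons.prems f(5) ij by simp
qed simp

section \<open>Length of climbing chains, and interpolating chains in explicit form\<close>

lemma chain_length_eq:
  assumes "w permutes {1..n}"
  shows "chain_length n w = rises n w"
proof -
  \<comment> \<open>The purely greedy chain provides existence, so that the set of lengths is a
    singleton and not empty.\<close>
  have "climbing_chain n w (chain_of (replicate (rises n w) (greedy_pair n)) w)"
    using assms selector_greedy by (intro climbing_chain_of) auto
  then have "length ` {C. climbing_chain n w C} = {rises n w}"
    using length_climbing_chain[of n w] by (auto intro!: image_eqI[rotated])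
  then show ?thesis
    unfolding chain_length_def by (intro the_equality) auto
qed

text \<open>Each link is determined by the links before it, which leaves one candidate; it is
  climbing because both rules are selectors.\<close>

lemma interp_chain_eq:
  assumes "w permutes {1..n}" "k \<le> rises n w"
  shows "interp_chain n w k =
    chain_of (replicate (rises n w - k) (greedy_pair n) @ replicate k (nested_pair n)) w"
    (is "_ = chain_of ?fs w")
  unfolding interp_chain_def chain_length_eq[OF assms(1)]
proof (rule the_equality)
  let ?C = "chain_of ?fs w"
  have len: "length ?fs = rises n w"
    using assms(2) by simp
  have nth: "?C ! p = (?fs ! p) (apply_links w (take p ?C))" if "p < rises n w" for p
    using chain_of_nth[of p ?fs w] that len by simp
  have "climbing_chain n w ?C"
    using assms selector_greedy selector_nested by (intro climbing_chain_of) auto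
  moreover have "greedy_link n w ?C p" if "p < rises n w - k" for p
    using nth[of p] that by (auto simp: greedy_link_def nth_append)
  moreover have "nested_link n w ?C p" if "p \<in> {rises n w - k..<rises n w}" for p
    using nth[of p] that by (auto simp: nested_link_def nth_append)
  ultimately show "climbing_chain n w ?C \<and> (\<forall>p<rises n w - k. greedy_link n w ?C p) \<and>
      (\<forall>p\<in>{rises n w - k..<rises n w}. nested_link n w ?C p)"
    by blast
next
  fix C
  assume C: "climbing_chain n w C \<and> (\<forall>p<rises n w - k. greedy_link n w C p) \<and>
      (\<forall>p\<in>{rises n w - k..<rises n w}. nested_link n w C p)"
  show "C = chain_of ?fs w"
  proof (rule chain_of_unique)
    show "length C = length ?fs"
      using C length_climbing_chain assms(2) by simp
    fix p assume "p < length ?fs"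
    then show "C ! p = (?fs ! p) (apply_links w (take p C))"
      using C assms(2) by (auto simp: nth_append greedy_link_def nested_link_def)
  qed
qed


section \<open>The weight of an interpolating chain\<close>

text \<open>The first argument is the link preceding the chain.\<close>

primrec marked :: "link \<Rightarrow> link list \<Rightarrow> link list" where
  "marked x [] = []"
| "marked x (l # C) =
     (if fst x < fst l \<or> fst x = fst l \<and> snd x < snd l then l # marked l C else marked l C)"

definition links_at :: "nat \<Rightarrow> link list \<Rightarrow> nat" where
  "links_at k C = length (filter (\<lambda>l. fst l = k) C)"

lemma links_at_simps [simp]:
  "links_at k [] = 0"
  "links_at k (l # C) = (if fst l = k then Suc (links_at k C) else links_at k C)"
  by (auto simp: links_at_def)

lemma set_marked:
  "set (marked x C) = {C ! p | p. p < length C \<and>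
     (fst ((x # C) ! p) < fst (C ! p) \<or>
      fst ((x # C) ! p) = fst (C ! p) \<and> snd ((x # C) ! p) < snd (C ! p))}"
proof (induction C arbitrary: x)
  case (Cons l C)
  have split: "{f p | p. p < length (l # C) \<and> Q p} =
      (if Q 0 then {f 0} else {}) \<union> {f (Suc p) | p. p < length C \<and> Q (Suc p)}"
    for f :: "nat \<Rightarrow> link" and Q
    by (auto simp: less_Suc_eq_0_disj)
  show ?case
    by (subst split) (simp add: Cons.IH)
qed simp

lemma min_markings_eq: "min_markings C = set (marked (0, 0) C)"
  by (simp add: min_markings_def set_marked)

lemma set_marked_subset: "set (marked x C) \<subseteq> set C"
  by (induction C arbitrary: x) (auto split: if_splits)

lemma distinct_marked: "distinct C \<Longrightarrow> distinct (marked x C)"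
  by (induction C arbitrary: x) (use set_marked_subset in fastforce)+

lemma set_marked_append:
  "set (marked x (C @ C')) = set (marked x C) \<union> set (marked (last (x # C)) C')"
  by (induction C arbitrary: x) auto

text \<open>The extra 1 in the length of the initial segment marks the first link of D in any case.
  So it does not matter which link precedes D, and the minimal marking of D may restart with (0,
  0).\<close>

lemma min_markings_append_take:
  assumes "D \<noteq> []" "fst (hd D) > 0"
  shows "min_markings (C @ D) \<union> set (take (length C + 1) (C @ D)) = set C \<union> set (marked (0, 0) D)"
proof -
  obtain l D' where D: "D = l # D'"
    using assms by (cases D) auto
  show ?thesis
    using assms set_marked_subset[of "(0, 0)" C] D
    by (auto simp: min_markings_eq set_marked_append split: if_splits)
qed

lemma card_links_at:
  "distinct C \<Longrightarrow> card {l \<in> set C. fst l = k} = links_at k C"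
  unfolding links_at_def by (metis distinct_card distinct_filter set_filter)

lemma rho_prefix:
  assumes "u permutes {1..n}" "\<And>k. k \<in> {1..<a} \<Longrightarrow> u k = n + 1 - k"
    and "k \<in> {1..<a}" "k \<le> n"
  shows "rho n u k = 0"
  using rho_le_rise[of k n u] rise_prefix[of u n a k] assms by auto

lemma rho_longest_perm: "k \<in> {1..n} \<Longrightarrow> rho n (longest_perm n) k = 0"
  using rho_le_rise[of k n "longest_perm n"] rise_longest_perm[of k n] by simp

section \<open>Change of \<open>rise\<close> and \<open>rho\<close> under one greedy or nested
  step\<close>

context
  fixes n :: nat and u :: "nat \<Rightarrow> nat"
  assumes perm: "u permutes {1..n}" and not_longest: "u \<noteq> longest_perm n"
begin

lemma below_after_step:
  assumes "selector n f" "k \<in> {1..<first_diff n u}"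
  shows "rise n (act u (f u)) k = 0" "rho n (act u (f u)) k = 0" "rise n u k = 0" "rho n u k = 0"
proof -
  have k: "k \<le> n"
    using assms(2) first_diff_mem[OF perm not_longest] by auto
  note s = selector_props(4)[OF assms(1) perm not_longest]
    selector_prefix[OF assms(1) perm not_longest]
  show "rise n (act u (f u)) k = 0" "rho n (act u (f u)) k = 0"
    using rise_prefix[OF s(1), of "first_diff n u"] rho_prefix[OF s(1), of "first_diff n u"]
      s(2) assms(2) k by blast+
  show "rise n u k = 0" "rho n u k = 0"
    using rise_prefix[OF perm, of "first_diff n u"] rho_prefix[OF perm, of "first_diff n u"]
      below_first_diff[OF perm not_longest] assms(2) k by blast+
qed

text \<open>The exchanged values are consecutive, so all comparisons among entries to the right of a
  survive. A subsequence from a through b loses one entry at most, since a takes over the value of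
  b.\<close>

lemma greedy_step:
  defines "a \<equiv> first_diff n u" and "v \<equiv> act u (greedy_pair n u)"
  shows "\<And>k. k \<in> {1..n} \<Longrightarrow> k \<noteq> a \<Longrightarrow> rise n v k = rise n u k"
    and "rise n u a = Suc (rise n v a)"
    and "\<And>k. k \<in> {1..n} \<Longrightarrow> k \<noteq> a \<Longrightarrow> rho n v k = rho n u k"
    and "rho n v a \<le> rho n u a"
    and "rho n u a \<le> Suc (rho n v a)"
proof -
  obtain b where g: "greedy_pair n u = (a, b)" and b: "b \<in> {a<..n}" "u b = Suc (u a)"
    using greedy_pair_props[OF perm not_longest] a_def by metis
  have v: "v = act u (a, b)"
    by (simp add: v_def g)
  have a: "a \<in> {1..n}"
    using first_diff_mem[OF perm not_longest] by (simp add: a_def)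
  note s = selector_props[OF selector_greedy perm not_longest, unfolded g]
  note ends = rise_act_ends[OF perm s(3)]
  have empty: "{l \<in> L. u a < u l \<and> u l < u b} = {}" for L
    using b by auto
  have low: "rise n v k = 0" "rho n v k = 0" "rise n u k = 0" "rho n u k = 0"
    if "k \<in> {1..<a}" for k
    using below_after_step[OF selector_greedy] that by (auto simp: a_def v_def)
  show "rise n u a = Suc (rise n v a)"
    using ends(1) unfolding v empty by simp
  have ord: "v k < v j \<longleftrightarrow> u k < u j" if "a < k" "a < j" for k j
  proof -
    have "u k \<noteq> u a" "u j \<noteq> u a" "k \<noteq> b \<Longrightarrow> u k \<noteq> u b" "j \<noteq> b \<Longrightarrow> u j \<noteq> u b"
      using permutes_inj[OF perm] that by (auto dest: injD)
    then show ?thesis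
      using that b unfolding v by (cases "k = b"; cases "j = b") (auto simp: act_apply)
  qed
  have rise_above: "rise n v k = rise n u k" if "a < k" for k
    unfolding rise_def by (rule arg_cong[where f = card]) (use ord that in auto)
  have rho_above: "rho n v k = rho n u k" if "k \<in> {a<..n}" for k
    using that
  proof (induction "n - k" arbitrary: k rule: less_induct)
    case less
    show ?case
      by (rule rho_cong) (use less ord in auto)
  qed
  show "rise n v k = rise n u k" "rho n v k = rho n u k" if "k \<in> {1..n}" "k \<noteq> a" for k
    using that low[of k] rise_above[of k] rho_above[of k] by (cases "k < a"; simp)+
  have va: "v a = u b" "v b = u a"
    by (auto simp: v act_apply)
  have up: "v j = u j" if "j \<in> {a<..n}" "j \<noteq> b" for j
    using that by (auto simp: v act_apply)
  show "rho n v a \<le> rho n u a"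
    using a
  proof (cases rule: rho_cases[of a n v])
    case (2 j)
    then have "u a < u j"
      using va b up[of j] by (cases "j = b") auto
    then show ?thesis
      using 2 rho_ge[OF a, of j u] rho_above[of j] by simp
  qed simp
  \<comment> \<open>After the exchange a carries the old value of b, so later entries above u b can
    follow a in v.\<close>
  have ge: "Suc (rho n u j) \<le> rho n v a" if "j \<in> {a<..n}" "u b < u j" for j
    using rho_ge[OF a, of j v] rho_above[of j] up[of j] va that by (cases "j = b") auto
  show "rho n u a \<le> Suc (rho n v a)"
    using a
  proof (cases rule: rho_cases[of a n u])
    case (2 j)
    show ?thesis
    proof (cases "j = b")
      case True
      have "b \<in> {1..n}"
        using b a by auto
      then have "rho n u b \<le> rho n v a"
      proof (cases rule: rho_cases[of b n u])
        case (2 i)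
        then show ?thesis
          using ge[of i] b by auto
      qed simp
      then show ?thesis
        using 2 True by simp
    next
      case False
      then have "u b \<noteq> u j"
        using permutes_inj[OF perm] by (auto dest: injD)
      then show ?thesis
        using ge[of j] 2 b by simp
    qed
  qed simp
qed

text \<open>At a, \<open>rho\<close> stays or drops by one, and comparing b with the partner b' of
  the next nested link decides which. Minimal markings make the same comparison, and so they count
  the drops.\<close>

lemma nested_step:
  defines "a \<equiv> first_diff n u" and "b \<equiv> snd (nested_pair n u)" and "v \<equiv> act u (nested_pair n u)"
  shows "\<And>k. k \<in> {1..n} \<Longrightarrow> k \<noteq> a \<Longrightarrow> rho n v k = rho n u k"
    and "rho n v a = 0 \<Longrightarrow> rho n u a = 1"
    and "nested_pair n v = (a, b') \<Longrightarrow> v \<noteq> longest_perm n \<Longrightarrow> first_diff n v = a \<Longrightarrow>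
      rho n u a = (if b < b' then Suc (rho n v a) else rho n v a)"
proof -
  have g: "nested_pair n u = (a, b)" and b: "b \<in> {a<..n}" "u a < u b" "rho n u a = Suc (rho n u b)"
    and last: "\<And>j. j \<in> {b<..n} \<Longrightarrow> u a < u j \<Longrightarrow> rho n u a \<noteq> Suc (rho n u j)"
    unfolding a_def b_def using nested_pair_props[OF perm not_longest] by (metis snd_conv)+
  have v: "v = act u (a, b)"
    by (simp add: v_def g)
  have a: "a \<in> {1..n}"
    using first_diff_mem[OF perm not_longest] by (simp add: a_def)
  have bn: "b \<in> {1..n}"
    using a b by auto
  have cov: "covering_link n u (a, b)"
    using selector_props(2)[OF selector_nested perm not_longest] by (simp add: g)
  have va: "v a = u b" "v b = u a"
    by (auto simp: v act_apply)
  have up: "v j = u j" if "j \<noteq> a" "j \<noteq> b" for j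
    using that by (auto simp: v act_apply)
  have rho_above: "rho n v k = rho n u k" if "k \<in> {a<..n}" for k
    using that
  proof (induction "n - k" arbitrary: k rule: less_induct)
    case less
    have IH: "rho n v j = rho n u j" if "j \<in> {k<..n}" for j
      using that less by auto
    have kn: "k \<in> {1..n}"
      using less.prems a by auto
    consider "k < b" | "k = b" | "b < k"
      by linarith
    then show ?case
    proof cases
      case 1
      have "u k \<noteq> u a"
        using permutes_inj[OF perm] less.prems by (auto dest: injD)
      moreover have "\<not> (u a < u k \<and> u k < u b)"
        using cov 1 less.prems by (auto simp: covering_link_def)
      \<comment> \<open>The value at k is not between u a and u b, so lowering the entry at b from u
        b to u a preserves comparisons with k.\<close>
      ultimately have ord: "v k < v j \<longleftrightarrow> u k < u j" if "j \<in> {k<..n}" for j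
        using 1 that less.prems va up[of k] up[of j] b by (cases "j = b") auto
      show ?thesis
        by (rule rho_cong[OF kn]) (use ord IH in blast)+
    next
      case 2
      have "rho n u b \<le> rho n v b"
        using bn
      proof (cases rule: rho_cases[of b n u])
        case (2 j)
        then show ?thesis
          using rho_ge[OF bn, of j v] IH[of j] \<open>k = b\<close> va up[of j] b by auto
      qed simp
      \<comment> \<open>The lowered entry at b may gain successors j, but these could also follow a
        in u. As b is the last optimal successor of a, \<open>rho\<close> at such j is strictly
        below \<open>rho\<close> at b.\<close>
      moreover have "rho n v b \<le> rho n u b"
        using bn
      proof (cases rule: rho_cases[of b n v])
        case (2 j)
        then have j: "j \<in> {b<..n}" "u a < u j" "rho n v b = Suc (rho n u j)"
          using IH[of j] \<open>k = b\<close> va up[of j] b by auto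
        then have "Suc (rho n u j) \<le> rho n u a"
          using rho_ge[OF a, of j u] b by auto
        then show ?thesis
          using last[OF j(1,2)] b(3) j(3) by simp
      qed simp
      ultimately show ?thesis
        using 2 by simp
    next
      case 3
      then have ord: "v k < v j \<longleftrightarrow> u k < u j" if "j \<in> {k<..n}" for j
        using up[of k] up[of j] that b(1) by simp
      show ?thesis
        by (rule rho_cong[OF kn]) (use ord IH in blast)+
    qed
  qed
  have low: "rho n v k = 0" "rho n u k = 0" if "k \<in> {1..<a}" for k
    using below_after_step[OF selector_nested] that by (auto simp: a_def v_def)
  show "rho n v k = rho n u k" if "k \<in> {1..n}" "k \<noteq> a" for k
    using that low[of k] rho_above[of k] by (cases "k < a") auto
  have "rho n v a \<le> rho n u a"
    using a
  proof (cases rule: rho_cases[of a n v])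
    case (2 j)
    then have "u a < u j"
      using va b up[of j] by (cases "j = b") auto
    then show ?thesis
      using 2 rho_ge[OF a, of j u] rho_above[of j] by simp
  qed simp
  have ge: "v a < v j" "Suc (rho n v j) \<le> rho n v a" if "j \<in> {b<..n}" "u b < u j" for j
    using rho_ge[OF a, of j v] rho_above[of j] up[of j] va that b by auto
  have "rho n u b \<le> rho n v a"
    using bn
  proof (cases rule: rho_cases[of b n u])
    case (2 j)
    then show ?thesis
      using ge[of j] rho_above[of j] b by simp
  qed simp
  then show "rho n u a = 1" if "rho n v a = 0"
    using that b by simp
  assume v': "nested_pair n v = (a, b')" "v \<noteq> longest_perm n" "first_diff n v = a"
  have pv: "v permutes {1..n}"
    using selector_props(4)[OF selector_nested perm not_longest] by (simp add: v_def)
  have b': "b' \<in> {a<..n}" "v a < v b'" "rho n v a = Suc (rho n v b')"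
    and last': "\<And>j. j \<in> {b'<..n} \<Longrightarrow> v a < v j \<Longrightarrow> rho n v a \<noteq> Suc (rho n v j)"
    using nested_pair_props[OF pv v'(2), unfolded v'(1,3)] by (metis prod.inject)+
  show "rho n u a = (if b < b' then Suc (rho n v a) else rho n v a)"
  proof (cases "b < b'")
    case True
    \<comment> \<open>Otherwise b' would be an optimal successor of a in u to the right of
      b.\<close>
    have "rho n v a \<noteq> rho n u a"
      using last[of b'] b' True va b up[of b'] rho_above[of b'] by auto
    then show ?thesis
      using True \<open>rho n v a \<le> rho n u a\<close> \<open>rho n u b \<le> rho n v a\<close> b by simp
  next
    case False
    have "b' \<noteq> b"
      using b'(2) va b by auto
    \<comment> \<open>Otherwise an optimal successor of b in u would be an optimal successor of a in
      v to the right of b, hence of b'.\<close>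
    have "rho n v a \<noteq> rho n u b"
    proof
      assume eq: "rho n v a = rho n u b"
      from bn show False
      proof (cases rule: rho_cases[of b n u])
        case 1
        then show ?thesis
          using eq b' by simp
      next
        case (2 j)
        then show ?thesis
          using last'[of j] ge(1)[of j] eq False \<open>b' \<noteq> b\<close> rho_above[of j] b by auto
      qed
    qed
    then show ?thesis
      using False \<open>rho n v a \<le> rho n u a\<close> \<open>rho n u b \<le> rho n v a\<close> b by simp
  qed
qed

end

section \<open>Links counted by first component in the greedy and nested blocks\<close>

lemma links_at_greedy_chain:
  assumes "u permutes {1..n}" "q \<le> rises n u" "k \<in> {1..n}"
  defines "C \<equiv> chain_of (replicate q (greedy_pair n)) u"
  shows "rise n u k = links_at k C + rise n (apply_links u C) k"
  using assms(1,2) unfolding C_def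
proof (induction q arbitrary: u)
  case (Suc q)
  have u: "u \<noteq> longest_perm n"
    using Suc.prems rises_eq_0_iff[of u n] by auto
  note g = selector_props[OF selector_greedy Suc.prems(1) u]
  show ?case
    using Suc.IH[OF g(4)] Suc.prems g(1,5) greedy_step(1)[OF Suc.prems(1) u assms(3)]
      greedy_step(2)[OF Suc.prems(1) u]
    by auto
qed simp

text \<open>A marking that starts from (0, 0) always marks the first link. Prepending a nested link
  therefore adds one marked link and may unmark the next one, in step with the change of
  \<open>rho\<close> at a.\<close>

lemma links_at_marked_nested_chain:
  assumes "u permutes {1..n}" "k \<in> {1..n}"
  shows "links_at k (marked (0, 0) (chain_of (replicate (rises n u) (nested_pair n)) u)) = rho n u k"
  using assms(1)
proof (induction "rises n u" arbitrary: u)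
  case 0
  then show ?case
    using rises_eq_0_iff[of u n] assms(2) rho_longest_perm[of k n] by auto
next
  case (Suc p)
  have u: "u \<noteq> longest_perm n"
    using Suc rises_eq_0_iff[of u n] by auto
  let ?l = "nested_pair n u"
  let ?v = "act u ?l" and ?a = "first_diff n u"
  let ?C = "chain_of (replicate p (nested_pair n)) ?v"
  note g = selector_props[OF selector_nested Suc.prems u]
  note step = nested_step[OF Suc.prems u]
  have l: "?l = (?a, snd ?l)"
    using g(1) by (simp add: prod_eq_iff)
  have a: "?a \<in> {1..n}"
    using first_diff_mem[OF Suc.prems u] .
  have p: "p = rises n ?v"
    using Suc g(5) by simp
  have IH: "links_at k (marked (0, 0) ?C) = rho n ?v k"
    using Suc.hyps(1)[OF p g(4)] p by simp
  have C: "chain_of (replicate (rises n u) (nested_pair n)) u = ?l # ?C"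
    using Suc.hyps(2)[symmetric] by simp
  have head: "marked (0, 0) (?l # ?C) = ?l # marked ?l ?C"
    using g(1) a by simp
  show ?case
  proof (cases p)
    case 0
    then have "?v = longest_perm n"
      using p rises_eq_0_iff[OF g(4)] by simp
    then have "rho n ?v ?a = 0"
      using rho_longest_perm[OF a] by simp
    then show ?thesis
      unfolding C head using 0 IH step(1)[of k] step(2) g(1) assms(2) by auto
  next
    case (Suc p')
    then have v: "?v \<noteq> longest_perm n"
      using p rises_eq_0_iff[OF g(4)] by simp
    note g' = selector_props[OF selector_nested g(4) v]
    let ?l' = "nested_pair n ?v"
    let ?C' = "chain_of (replicate p' (nested_pair n)) (act ?v ?l')"
    have C': "?C = ?l' # ?C'"
      using Suc by simp
    have l': "?l' = (first_diff n ?v, snd ?l')"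
      using g'(1) by (simp add: prod_eq_iff)
    have le: "?a \<le> first_diff n ?v"
      by (rule selector_first_diff[OF selector_nested Suc.prems u v])
    have m0: "marked (0, 0) ?C = ?l' # marked ?l' ?C'"
      unfolding C' using g'(1) first_diff_mem[OF g(4) v] by simp
    show ?thesis
    proof (cases "first_diff n ?v = ?a")
      case True
      \<comment> \<open>If the next link loses its mark, the new first link replaces it in the count
        and \<open>rho\<close> at a is unchanged.\<close>
      have "rho n u ?a = (if snd ?l < snd ?l' then Suc (rho n ?v ?a) else rho n ?v ?a)"
        using step(3)[of "snd ?l'"] l' v True by simp
      moreover have "marked ?l ?C = (if snd ?l < snd ?l' then marked (0, 0) ?C else marked ?l' ?C')"
        unfolding m0 unfolding C' using g(1) g'(1) True by simp
      ultimately show ?thesis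
        unfolding C head using IH step(1)[of k] assms(2) g(1) g'(1) True m0
        by (auto split: if_splits)
    next
      case False
      \<comment> \<open>The new link is the last one at a: the entry there is now final, so
        \<open>rho\<close> is 0 after the step and was 1 before it.\<close>
      then have "marked ?l ?C = marked (0, 0) ?C"
        unfolding m0 unfolding C' using g(1) g'(1) le by simp
      moreover have "rho n ?v ?a = 0"
        using rho_prefix[OF g(4), of "first_diff n ?v" ?a] below_first_diff[OF g(4) v] le False a
        by auto
      ultimately show ?thesis
        unfolding C head using IH step(1)[of k] step(2) assms(2) g(1) by auto
    qed
  qed
qed

definition excess :: "nat \<Rightarrow> (nat \<Rightarrow> nat) \<Rightarrow> nat \<Rightarrow> int" where
  "excess n u k = (if k \<in> {1..n} then int (rise n u k) - int (rho n u k) else 0)"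

definition greedy_state :: "nat \<Rightarrow> (nat \<Rightarrow> nat) \<Rightarrow> nat \<Rightarrow> nat \<Rightarrow> nat" where
  "greedy_state n w q = apply_links w (chain_of (replicate q (greedy_pair n)) w)"

lemma greedy_state_0 [simp]: "greedy_state n w 0 = w"
  by (simp add: greedy_state_def)

lemma greedy_state_Suc:
  "greedy_state n w (Suc q) = act (greedy_state n w q) (greedy_pair n (greedy_state n w q))"
  unfolding greedy_state_def replicate_Suc replicate_append_same[symmetric] chain_of_append by simp

lemma greedy_state_props:
  assumes "w permutes {1..n}" "q \<le> rises n w"
  shows "greedy_state n w q permutes {1..n}" "rises n (greedy_state n w q) = rises n w - q"
  using chain_of_state[of w n "replicate q (greedy_pair n)"] assms selector_greedy
  by (auto simp: greedy_state_def)

text \<open>At k the greedy block contributes \<open>rise\<close> of w minus \<open>rise\<close> of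
  u, and the marked nested links contribute \<open>rho\<close> of u. Subtracting both from n - k
  leaves \<open>invcode\<close> of w plus \<open>excess\<close> of u.\<close>

lemma chain_wt_xi:
  assumes w: "w permutes {1..n}" and p: "p \<le> rises n w"
  shows "chain_wt n (xi n w p) =
    (\<lambda>k. invcode n w k + excess n (greedy_state n w (rises n w - p)) k)"
proof
  fix k
  let ?q = "rises n w - p"
  let ?u = "greedy_state n w ?q"
  let ?G = "chain_of (replicate ?q (greedy_pair n)) w" and ?N = "chain_of (replicate p (nested_pair n)) ?u"
  let ?U = "set ?G \<union> set (marked (0, 0) ?N)"
  note u = greedy_state_props[OF w, of ?q]
  have ru: "rises n ?u = p"
    using u(2) p by simp
  have I: "interp_chain n w p = ?G @ ?N"
    using interp_chain_eq[OF w p] by (simp add: chain_of_append greedy_state_def)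
  have "interp_marking n w p = ?U"
  proof (cases "p = 0")
    case True
    then show ?thesis
      using I by (simp add: interp_marking_def)
  next
    case False
    then obtain p' where p': "p = Suc p'"
      by (cases p) auto
    have "?u \<noteq> longest_perm n"
      using rises_eq_0_iff[of ?u n] u ru False by simp
    then have "fst (hd ?N) > 0"
      using selector_props(1)[OF selector_nested u(1)] first_diff_mem[OF u(1)] p' by fastforce
    then show ?thesis
      using min_markings_append_take[of ?N ?G] p' I False chain_length_eq[OF w]
      by (simp add: interp_marking_def)
  qed
  then have wt: "chain_wt n (xi n w p) k =
      (if k \<in> {1..n} then int n - int k - int (card {l \<in> ?U. fst l = k}) else 0)"
    by (simp add: chain_wt_def xi_def)
  show "chain_wt n (xi n w p) k = invcode n w k + excess n ?u k"
  proof (cases "k \<in> {1..n}")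
    case True
    have "distinct (interp_chain n w p)"
      unfolding interp_chain_eq[OF w p]
      by (rule distinct_chain_of[OF w]) (use p selector_greedy selector_nested in auto)
    then have d: "distinct ?G" "distinct ?N" "set ?G \<inter> set ?N = {}"
      unfolding I by auto
    have "{l \<in> ?U. fst l = k} = {l \<in> set ?G. fst l = k} \<union> {l \<in> set (marked (0, 0) ?N). fst l = k}"
      by auto
    then have "card {l \<in> ?U. fst l = k} =
        card {l \<in> set ?G. fst l = k} + card {l \<in> set (marked (0, 0) ?N). fst l = k}"
      using d(3) set_marked_subset[of "(0, 0)" ?N] by (simp only:, intro card_Un_disjoint) auto
    also have "\<dots> = links_at k ?G + links_at k (marked (0, 0) ?N)"
      unfolding card_links_at[OF d(1)] card_links_at[OF distinct_marked[OF d(2)]] ..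
    also have "links_at k (marked (0, 0) ?N) = rho n ?u k"
      using links_at_marked_nested_chain[OF u(1) True] ru by simp
    finally show ?thesis
      using wt True links_at_greedy_chain[OF w _ True, of ?q] invcode_eq_rise[OF w True]
      by (simp add: excess_def greedy_state_def)
  next
    case False
    then show ?thesis
      unfolding wt invcode_def excess_def by (simp only: if_False)
  qed
qed


section \<open>Leads\<close>

definition truncation :: "(nat \<Rightarrow> int) \<Rightarrow> (nat \<Rightarrow> int) \<Rightarrow> bool" where
  "truncation D E \<longleftrightarrow> (\<exists>j. (\<forall>k<j. E k = 0) \<and> 0 \<le> E j \<and> E j \<le> D j \<and> (\<forall>k>j. E k = D k))"

text \<open>Truncations of a nonnegative vector are totally ordered componentwise: moving the cut
  position to the right decreases the vector. Comparable vectors with equal sums coincide.\<close>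

lemma truncation_unique:
  assumes D: "\<And>k. 0 \<le> D k" "\<And>k. k \<notin> {1..n} \<Longrightarrow> D k = 0"
    and E: "truncation D E" "truncation D E'" "vec_size n E = vec_size n E'"
  shows "E = E'"
proof -
  have mono: "\<forall>k. E' k \<le> E k"
    if "\<forall>k<j. E k = 0" "\<forall>k<j'. E' k = 0" "\<forall>k>j. E k = D k" "\<forall>k>j'. E' k = D k"
      "0 \<le> E j" "E' j' \<le> D j'" "j < j'" for E E' j j'
  proof
    fix k
    show "E' k \<le> E k"
      using that D(1)[of k] by (cases k j rule: linorder_cases; cases k j' rule: linorder_cases) auto
  qed
  have eq: "E = E'"
    if "\<forall>k. E' k \<le> E k" "truncation D E" "truncation D E'" "vec_size n E = vec_size n E'" for E E'
  proof
    fix k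
    have le: "\<forall>i. 0 \<le> X i \<and> X i \<le> D i" if "truncation D X" for X
      using that D(1) unfolding truncation_def by (metis linorder_neqE_nat order_refl)
    show "E k = E' k"
    proof (cases "k \<in> {1..n}")
      case True
      have "sum (\<lambda>k. E k - E' k) {1..n} = 0"
        using that(4) by (simp add: vec_size_def sum_subtractf)
      then show ?thesis
        using that(1) True by (subst (asm) sum_nonneg_eq_0_iff) auto
    next
      case False
      then show ?thesis
        using le that(2,3) D(2)[of k] by (metis order_antisym)
    qed
  qed
  obtain j where j: "\<forall>k<j. E k = 0" "0 \<le> E j" "E j \<le> D j" "\<forall>k>j. E k = D k"
    using E(1) by (auto simp: truncation_def)
  obtain j' where j': "\<forall>k<j'. E' k = 0" "0 \<le> E' j'" "E' j' \<le> D j'" "\<forall>k>j'. E' k = D k"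
    using E(2) by (auto simp: truncation_def)
  have "(\<forall>k. E' k \<le> E k) \<or> (\<forall>k. E k \<le> E' k)"
  proof (cases j j' rule: linorder_cases)
    case equal
    then have "E k = E' k" if "k \<noteq> j" for k
      using that j j' by (metis linorder_neqE_nat)
    then show ?thesis
      by (metis linear order_refl)
  qed (use mono[of j E j' E'] mono[of j' E' j E] j j' in auto)
  then show ?thesis
    using eq[of E' E] eq[of E E'] E by metis
qed

text \<open>Each step fills the last incomplete entry, which can serve as the new cut
  position.\<close>

lemma lead_truncation:
  assumes D: "\<And>k. 0 \<le> D k" "\<And>k. k \<notin> {1..n} \<Longrightarrow> D k = 0"
    and raj: "rajcode n w = (\<lambda>k. invcode n w k + D k)"
    and "int i \<le> vec_size n D"
  obtains E where "lead n w i = (\<lambda>k. invcode n w k + E k)" "truncation D E" "vec_size n E = int i"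
  using \<open>int i \<le> vec_size n D\<close>
proof (induction i arbitrary: thesis)
  case 0
  have "truncation D (\<lambda>k. 0)"
    \<comment> \<open>The cut lies beyond the support of D, which makes the zero vector a
      truncation.\<close>
    unfolding truncation_def using D by (intro exI[of _ "Suc n"]) auto
  then show ?case
    by (intro 0(1)) (auto simp: vec_size_def)
next
  case (Suc i)
  obtain E where E: "lead n w i = (\<lambda>k. invcode n w k + E k)" "truncation D E" "vec_size n E = int i"
    using Suc.IH Suc.prems(2) by auto
  obtain j where j: "\<forall>k<j. E k = 0" "0 \<le> E j" "E j \<le> D j" "\<forall>k>j. E k = D k"
    using E(2) by (auto simp: truncation_def)
  have le: "E k \<le> D k" for k
    using j D(1)[of k] by (cases k j rule: linorder_cases) auto
  let ?S = "{j \<in> {1..n}. lead n w i j < rajcode n w j}"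
  have S: "?S = {j \<in> {1..n}. E j < D j}"
    by (simp add: E(1) raj)
  \<comment> \<open>The sum of E is still below that of D, so the maximum in \<open>lead\<close> is
    taken over a nonempty set.\<close>
  have "?S \<noteq> {}"
  proof
    assume "?S = {}"
    then have "vec_size n D \<le> vec_size n E"
      unfolding S vec_size_def by (intro sum_mono) (auto simp: not_less)
    then show False
      using E(3) Suc.prems(2) by simp
  qed
  define m where "m = Max ?S"
  have "m \<in> ?S"
    unfolding m_def using \<open>?S \<noteq> {}\<close> by (intro Max_in) auto
  then have m: "m \<in> {1..n}" "E m < D m"
    unfolding S by auto
  have above: "E k = D k" if "k > m" for k
  proof (rule ccontr)
    assume ne: "E k \<noteq> D k"
    moreover have "k \<le> n"
    proof (rule ccontr)
      assume "\<not> k \<le> n"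
      then have "D k = 0"
        using D(2) by simp
      moreover have "E k \<ge> 0"
        using j D(1)[of k] by (cases k j rule: linorder_cases) auto
      ultimately show False
        using ne le[of k] by simp
    qed
    ultimately have "k \<in> ?S"
      unfolding S using le[of k] m that by (auto simp: order_le_less)
    then have "k \<le> m"
      unfolding m_def by (intro Max_ge) auto
    then show False
      using that by simp
  qed
  \<comment> \<open>Entries beyond the old cut j are complete, so m is not among them and all
    entries before m are zero.\<close>
  have "m \<le> j"
    using j(4) m(2) by (metis less_irrefl not_le)
  let ?E = "\<lambda>k. E k + unit_vec m k"
  show ?case
  proof (rule Suc.prems(1))
    show "lead n w (Suc i) = (\<lambda>k. invcode n w k + ?E k)"
      using E(1) by (simp add: m_def add.assoc)
    have "E m \<ge> 0"
      using j \<open>m \<le> j\<close> by (cases "m = j") auto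
    then show "truncation D ?E"
      unfolding truncation_def using m above j(1) \<open>m \<le> j\<close>
      by (intro exI[of _ m]) (auto simp: unit_vec_def)
    have "vec_size n ?E = vec_size n E + (\<Sum>k = 1..n. unit_vec m k)"
      by (simp add: vec_size_def sum.distrib)
    also have "(\<Sum>k = 1..n. unit_vec m k) = 1"
      using m(1) by (simp add: unit_vec_def)
    finally show "vec_size n ?E = int (Suc i)"
      using E(3) by simp
  qed
qed

section \<open>The excess along the greedy chain\<close>

lemma excess_nonneg: "0 \<le> excess n u k"
  using rho_le_rise[of k n u] by (simp add: excess_def)

lemma rajcode_eq_excess:
  "w permutes {1..n} \<Longrightarrow> rajcode n w = (\<lambda>k. invcode n w k + excess n w k)"
  using invcode_eq_rise[of w n] rajcode_eq_rho[of _ n w]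
  by (intro ext) (simp add: excess_def, simp add: rajcode_def invcode_def)

lemma excess_longest_perm: "excess n (longest_perm n) k = 0"
  using rise_longest_perm[of k n] rho_longest_perm[of k n] by (auto simp: excess_def)

context
  fixes n :: nat and w :: "nat \<Rightarrow> nat"
  assumes w: "w permutes {1..n}"
begin

lemma greedy_state_not_longest:
  assumes "q < rises n w"
  shows "greedy_state n w q \<noteq> longest_perm n"
  using greedy_state_props[OF w, of q] assms rises_longest_perm by auto

lemma excess_greedy_state_Suc:
  assumes "q < rises n w"
  defines "u \<equiv> greedy_state n w q" and "v \<equiv> greedy_state n w (Suc q)"
  shows "\<And>k. k \<noteq> first_diff n u \<Longrightarrow> excess n v k = excess n u k"
    and "excess n v (first_diff n u) \<le> excess n u (first_diff n u)"
    and "excess n u (first_diff n u) \<le> excess n v (first_diff n u) + 1"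
proof -
  have u: "u permutes {1..n}" "u \<noteq> longest_perm n"
    using greedy_state_props[OF w, of q] greedy_state_not_longest assms by (auto simp: u_def)
  have v: "v = act u (greedy_pair n u)"
    by (simp add: u_def v_def greedy_state_Suc)
  note g = greedy_step[OF u, folded v]
  show "excess n v k = excess n u k" if "k \<noteq> first_diff n u" for k
    using g(1,3)[of k] that by (simp add: excess_def)
  show "excess n v (first_diff n u) \<le> excess n u (first_diff n u)"
    and "excess n u (first_diff n u) \<le> excess n v (first_diff n u) + 1"
    using g(2,4,5) by (auto simp: excess_def)
qed

lemma vec_size_greedy_state_Suc:
  assumes "q < rises n w"
  shows "vec_size n (excess n (greedy_state n w q)) \<le>
    vec_size n (excess n (greedy_state n w (Suc q))) + 1"
proof -
  let ?a = "first_diff n (greedy_state n w q)"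
  have a: "?a \<in> {1..n}"
    using first_diff_mem greedy_state_props(1)[OF w, of q] greedy_state_not_longest assms by auto
  have "vec_size n (excess n (greedy_state n w q)) \<le>
      (\<Sum>k = 1..n. excess n (greedy_state n w (Suc q)) k + unit_vec ?a k)"
    unfolding vec_size_def using excess_greedy_state_Suc[OF assms]
    by (intro sum_mono) (auto simp: unit_vec_def)
  also have "\<dots> = vec_size n (excess n (greedy_state n w (Suc q))) + 1"
    using a by (simp add: sum.distrib vec_size_def unit_vec_def)
  finally show ?thesis .
qed

lemma excess_greedy_state_le:
  assumes "q \<le> rises n w"
  shows "excess n (greedy_state n w q) k \<le> excess n w k"
  using assms
proof (induction q)
  case (Suc q)
  then show ?case
    using excess_greedy_state_Suc[of q]
    by (cases "k = first_diff n (greedy_state n w q)") (auto intro: order_trans)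
qed simp

text \<open>Earlier greedy steps act at or to the left of the current first difference, so entries
  beyond it are still those of w.\<close>

lemma excess_greedy_state_above:
  assumes "q < rises n w" "k > first_diff n (greedy_state n w q)"
  shows "excess n (greedy_state n w q) k = excess n w k"
  using assms
proof (induction q)
  case (Suc q)
  let ?u = "greedy_state n w q"
  have "?u permutes {1..n}" "?u \<noteq> longest_perm n"
    using greedy_state_props(1)[OF w, of q] greedy_state_not_longest[of q] Suc.prems by auto
  moreover have "greedy_state n w (Suc q) \<noteq> longest_perm n"
    using greedy_state_not_longest Suc.prems by blast
  ultimately have "first_diff n ?u < k"
    using selector_first_diff[OF selector_greedy, of ?u n] Suc.prems(2)
    by (simp add: greedy_state_Suc)
  then show ?case
    using Suc excess_greedy_state_Suc(1)[of q k] by simp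
qed simp

text \<open>The first difference from w_0 is the cut position; at w_0 itself, where there is none, n
  + 1 takes its place.\<close>

lemma truncation_greedy_state:
  assumes "q \<le> rises n w"
  shows "truncation (excess n w) (excess n (greedy_state n w q))"
proof (cases "q = rises n w")
  case True
  then have "greedy_state n w q = longest_perm n"
    using greedy_state_props[OF w, of q] rises_eq_0_iff by auto
  then show ?thesis
    unfolding truncation_def
    by (intro exI[of _ "Suc n"]) (auto simp: excess_longest_perm, auto simp: excess_def)
next
  case False
  let ?u = "greedy_state n w q"
  have q: "q < rises n w"
    using False assms by simp
  have u: "?u permutes {1..n}" "?u \<noteq> longest_perm n"
    using greedy_state_props(1)[OF w, of q] greedy_state_not_longest[OF q] assms by auto
  have "excess n ?u k = 0" if "k < first_diff n ?u" for k
    using below_after_step(3,4)[OF u selector_greedy, of k] that by (auto simp: excess_def)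
  then show ?thesis
    unfolding truncation_def
    using excess_nonneg excess_greedy_state_le[OF assms] excess_greedy_state_above[OF q]
    by blast
qed

text \<open>A discrete intermediate value argument: the sum ends at 0 and never drops by more than
  one, so the first value that is at most s equals s.\<close>

lemma vec_size_greedy_state_surj:
  assumes "0 \<le> s" "s \<le> vec_size n (excess n w)"
  obtains q where "q \<le> rises n w" "vec_size n (excess n (greedy_state n w q)) = s"
proof -
  let ?f = "\<lambda>q. vec_size n (excess n (greedy_state n w q))"
  have "greedy_state n w (rises n w) = longest_perm n"
    using greedy_state_props[OF w, of "rises n w"] rises_eq_0_iff by auto
  then have "?f (rises n w) \<le> s"
    using assms(1) by (simp add: vec_size_def excess_longest_perm)
  then obtain q where q: "q \<le> rises n w" "?f q \<le> s" "\<And>p. p < q \<Longrightarrow> \<not> ?f p \<le> s"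
    using ex_least_nat_le[of "\<lambda>q. ?f q \<le> s" "rises n w"] by auto
  have "s \<le> ?f q"
  proof (cases q)
    case 0
    then show ?thesis
      using assms(2) by simp
  next
    case (Suc p)
    then show ?thesis
      using q(1) q(3)[of p] vec_size_greedy_state_Suc[of p] by simp
  qed
  then show ?thesis
    using that q by auto
qed

end

section \<open>Leads and interpolating chains matched by the sum of the excess\<close>

theorem theorem9p9:
  fixes n :: nat and w :: "nat \<Rightarrow> nat"
  assumes "w permutes {1..n}"
  shows "set (leads n w) = {chain_wt n (xi n w p) | p. p \<le> chain_length n w}"
proof -
  let ?D = "excess n w" and ?m = "rises n w"
  let ?W = "\<lambda>q k. invcode n w k + excess n (greedy_state n w q) k"
  note raj = rajcode_eq_excess[OF assms]
  have D: "0 \<le> ?D k" "k \<notin> {1..n} \<Longrightarrow> ?D k = 0" for k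
    using excess_nonneg by (auto simp: excess_def)
  have size: "raj_size n w - inv_size n w = vec_size n ?D"
    by (simp add: raj_size_def inv_size_def raj vec_size_def sum.distrib)
  have nonneg: "0 \<le> vec_size n (excess n u)" for u
    using excess_nonneg by (simp add: vec_size_def sum_nonneg)
  \<comment> \<open>Both sides are \<open>invcode\<close> plus a truncation of the excess of w with
    sum i.\<close>
  have lead_eq: "lead n w i = ?W q"
    if q: "q \<le> ?m" "vec_size n (excess n (greedy_state n w q)) = int i" and i: "int i \<le> vec_size n ?D" for i q
  proof -
    obtain E where E: "lead n w i = (\<lambda>k. invcode n w k + E k)" "truncation ?D E" "vec_size n E = int i"
      using lead_truncation[OF D raj i] by blast
    have "E = excess n (greedy_state n w q)"
      using truncation_unique[OF D E(2) truncation_greedy_state[OF assms q(1)]] E(3) q(2)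
      by simp
    then show ?thesis
      using E(1) by simp
  qed
  have "set (leads n w) = {lead n w i | i. int i \<le> vec_size n ?D}"
  proof -
    have "set [0..<nat (vec_size n ?D) + 1] = {i. int i \<le> vec_size n ?D}"
      using nonneg[of w] by (auto simp del: upt_Suc)
    then show ?thesis
      unfolding leads_def size set_map by blast
  qed
  also have "\<dots> = {?W q | q. q \<le> ?m}"
  proof (intro equalityI subsetI)
    fix x assume "x \<in> {lead n w i | i. int i \<le> vec_size n ?D}"
    then obtain i where i: "x = lead n w i" "int i \<le> vec_size n ?D"
      by auto
    obtain q where "q \<le> ?m" "vec_size n (excess n (greedy_state n w q)) = int i"
      using vec_size_greedy_state_surj[OF assms _ i(2)] by auto
    then show "x \<in> {?W q | q. q \<le> ?m}"
      using lead_eq i by blast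
  next
    fix x assume "x \<in> {?W q | q. q \<le> ?m}"
    then obtain q where q: "x = ?W q" "q \<le> ?m"
      by auto
    let ?s = "vec_size n (excess n (greedy_state n w q))"
    have "?s \<le> vec_size n ?D"
      unfolding vec_size_def by (intro sum_mono excess_greedy_state_le assms q)
    then have "lead n w (nat ?s) = x" "int (nat ?s) \<le> vec_size n ?D"
      using lead_eq[of q "nat ?s"] q nonneg by auto
    then show "x \<in> {lead n w i | i. int i \<le> vec_size n ?D}"
      by blast
  qed
  \<comment> \<open>The p-th interpolating chain has m - p greedy links.\<close>
  also have "\<dots> = {?W (?m - p) | p. p \<le> ?m}"
    by (auto, metis diff_diff_cancel diff_le_self)
  also have "\<dots> = {chain_wt n (xi n w p) | p. p \<le> chain_length n w}"
  proof -
    have "?W (?m - p) = chain_wt n (xi n w p)" if "p \<le> ?m" for p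
      using chain_wt_xi[OF assms that] by simp
    then show ?thesis
      unfolding chain_length_eq[OF assms] by (intro Collect_cong ex_cong1) metis
  qed
  finally show ?thesis .
qed

end
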